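(* Let $(\mathbb{Z},b,m)$ be a star with two rays which is recurrent. Then $(\mathbb{Z},b,m)$ does not satisfy the $\ell^2$-Liouville property if and only if both $L_c^{(\infty)}$ and $L_c^{(-\infty)}$ are not essentially self-adjoint.
   Context: A star with two rays $(\mathbb{Z},b,m)$ consists of the vertex set $\mathbb{Z}$, a symmetric $b\colon\mathbb{Z}\times\mathbb{Z}\to[0,\infty)$ with $b(x,y)>0$ iff $|x-y|=1$, and $m\colon\mathbb{Z}\to(0,\infty)$. All functions are real-valued; $\ell^2(\mathbb{Z},m)$ is the space of $f$ with $\|f\|^2=\sum_x f^2(x)m(x)<\infty$. The formal Laplacian is $\Delta f(x)=\frac1{m(x)}\sum_y b(x,y)(f(x)-f(y))$. A function $f$ is harmonic if $\Delta f=0$. The $\ell^2$-Liouville property holds if every harmonic function in $\ell^2(\mathbb{Z},m)$ is constant. Recurrence: let $\mathcal{Q}(f)=\frac12\sum_{x,y}b(x,y)(f(x)-f(y))^2$, let $Q^{(D)}$ be the restriction of $\mathcal{Q}$ to the closure of the finitely supported functions with respect to $(\|f\|^2+\mathcal{Q}(f))^{1/2}$, and let $L$ be the self-adjoint operator on $\ell^2(\mathbb{Z},m)$ associated with $Q^{(D)}$. The graph is transient if $\int_0^\infty e^{-tL}1_y(x)\,dt<\infty$ for some (equivalently all) $x,y$, where $1_y$ is the indicator function of $\{y\}$, and recurrent otherwise. $L_c^{(\infty)}$ and $L_c^{(-\infty)}$ are the Laplacians of the positive part and the negative part of the graph, i.e. of the subgraphs induced on $\{1,2,3,\ldots\}$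 and on $\{-1,-2,-3,\ldots\}$ (with $b$ and $m$ restricted), each restricted to the finitely supported functions and viewed as an operator on the corresponding $\ell^2$ space. An operator is essentially self-adjoint if it has a unique self-adjoint extension (equivalently, its closure is self-adjoint). *)

theory Defs
  imports "HOL-Analysis.Analysis"
begin

text \<open>
  A weighted graph is given by a vertex set \<open>X\<close>, edge weights \<open>b\<close> and a vertex measure \<open>m\<close>.
  A real function on \<open>X\<close> is represented by the function on the ambient type that vanishes
  outside \<open>X\<close>, so that equality on \<open>X\<close> is equality. The subgraph induced on \<open>Y \<subseteq> X\<close> is obtained
  by using the same \<open>b\<close> and \<open>m\<close> with \<open>Y\<close> in place of \<open>X\<close>.
\<close>

definition star_with_two_rays :: "(int \<Rightarrow> int \<Rightarrow> real) \<Rightarrow> (int \<Rightarrow> real) \<Rightarrow> bool" where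
  "star_with_two_rays b m \<longleftrightarrow>
     (\<forall>x y. b x y = b y x) \<and> (\<forall>x y. b x y \<ge> 0) \<and>
     (\<forall>x y. b x y > 0 \<longleftrightarrow> \<bar>x - y\<bar> = 1) \<and> (\<forall>x. m x > 0)"

definition l2 :: "'a set \<Rightarrow> ('a \<Rightarrow> real) \<Rightarrow> ('a \<Rightarrow> real) set" where
  "l2 X m = {f. (\<forall>x. x \<notin> X \<longrightarrow> f x = 0) \<and> (\<lambda>x. (f x)\<^sup>2 * m x) summable_on X}"

definition l2_inner :: "'a set \<Rightarrow> ('a \<Rightarrow> real) \<Rightarrow> ('a \<Rightarrow> real) \<Rightarrow> ('a \<Rightarrow> real) \<Rightarrow> real" where
  "l2_inner X m f g = (\<Sum>\<^sub>\<infinity>x\<in>X. f x * g x * m x)"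

definition l2_norm :: "'a set \<Rightarrow> ('a \<Rightarrow> real) \<Rightarrow> ('a \<Rightarrow> real) \<Rightarrow> real" where
  "l2_norm X m f = sqrt (\<Sum>\<^sub>\<infinity>x\<in>X. (f x)\<^sup>2 * m x)"

definition finitely_supported :: "'a set \<Rightarrow> ('a \<Rightarrow> real) set" where
  "finitely_supported X = {f. finite {x. f x \<noteq> 0} \<and> {x. f x \<noteq> 0} \<subseteq> X}"

text \<open>On a locally finite graph the sum below has only finitely many nonzero terms, hence it is
  meaningful for every function.\<close>

definition laplacian ::
    "'a set \<Rightarrow> ('a \<Rightarrow> 'a \<Rightarrow> real) \<Rightarrow> ('a \<Rightarrow> real) \<Rightarrow> ('a \<Rightarrow> real) \<Rightarrow> ('a \<Rightarrow> real)" where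
  "laplacian X b m f x =
     (if x \<in> X then (1 / m x) * (\<Sum>\<^sub>\<infinity>y\<in>X. b x y * (f x - f y)) else 0)"

definition harmonic ::
    "'a set \<Rightarrow> ('a \<Rightarrow> 'a \<Rightarrow> real) \<Rightarrow> ('a \<Rightarrow> real) \<Rightarrow> ('a \<Rightarrow> real) \<Rightarrow> bool" where
  "harmonic X b m f \<longleftrightarrow> (\<forall>x\<in>X. laplacian X b m f x = 0)"

definition l2_liouville :: "'a set \<Rightarrow> ('a \<Rightarrow> 'a \<Rightarrow> real) \<Rightarrow> ('a \<Rightarrow> real) \<Rightarrow> bool" where
  "l2_liouville X b m \<longleftrightarrow>
     (\<forall>f. f \<in> l2 X m \<and> harmonic X b m f \<longrightarrow> (\<exists>c. \<forall>x\<in>X. f x = c))"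

definition finite_energy :: "'a set \<Rightarrow> ('a \<Rightarrow> 'a \<Rightarrow> real) \<Rightarrow> ('a \<Rightarrow> real) \<Rightarrow> bool" where
  "finite_energy X b f \<longleftrightarrow> (\<lambda>(x, y). b x y * (f x - f y)\<^sup>2) summable_on X \<times> X"

text \<open>The value is only meaningful (and only used) for functions of finite energy;
  \<open>infsum\<close> is 0 on divergent sums.\<close>

definition energy :: "'a set \<Rightarrow> ('a \<Rightarrow> 'a \<Rightarrow> real) \<Rightarrow> ('a \<Rightarrow> real) \<Rightarrow> real" where
  "energy X b f = (\<Sum>\<^sub>\<infinity>(x, y)\<in>X \<times> X. b x y * (f x - f y)\<^sup>2) / 2"

definition energy_form ::
    "'a set \<Rightarrow> ('a \<Rightarrow> 'a \<Rightarrow> real) \<Rightarrow> ('a \<Rightarrow> real) \<Rightarrow> ('a \<Rightarrow> real) \<Rightarrow> real" where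
  "energy_form X b f g = (\<Sum>\<^sub>\<infinity>(x, y)\<in>X \<times> X. b x y * (f x - f y) * (g x - g y)) / 2"

definition dirichlet_domain ::
    "'a set \<Rightarrow> ('a \<Rightarrow> 'a \<Rightarrow> real) \<Rightarrow> ('a \<Rightarrow> real) \<Rightarrow> ('a \<Rightarrow> real) set" where
  "dirichlet_domain X b m =
     {f. f \<in> l2 X m \<and> finite_energy X b f \<and>
         (\<exists>\<phi> :: nat \<Rightarrow> 'a \<Rightarrow> real. (\<forall>n. \<phi> n \<in> finitely_supported X) \<and>
            (\<lambda>n. sqrt ((l2_norm X m (\<lambda>x. f x - \<phi> n x))\<^sup>2 + energy X b (\<lambda>x. f x - \<phi> n x)))
              \<longlonglongrightarrow> 0)}"

text \<open>
  An unbounded operator in \<open>l2 X m\<close> is represented by its graph, the set of all pairs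
  \<open>(f, A f)\<close> with \<open>f\<close> in the domain; extension of operators is then inclusion.
\<close>

type_synonym 'a oper = "(('a \<Rightarrow> real) \<times> ('a \<Rightarrow> real)) set"

text \<open>The operator associated with the closed form \<open>Q\<^sup>D\<close>:
  \<open>L f = g\<close> iff \<open>f \<in> D(Q\<^sup>D)\<close> and \<open>Q\<^sup>D(f, h) = \<langle>g, h\<rangle>\<close> for all \<open>h \<in> D(Q\<^sup>D)\<close>.\<close>

definition dirichlet_laplacian ::
    "'a set \<Rightarrow> ('a \<Rightarrow> 'a \<Rightarrow> real) \<Rightarrow> ('a \<Rightarrow> real) \<Rightarrow> 'a oper" where
  "dirichlet_laplacian X b m =
     {(f, g). f \<in> dirichlet_domain X b m \<and> g \<in> l2 X m \<and>
        (\<forall>h \<in> dirichlet_domain X b m. energy_form X b f h = l2_inner X m g h)}"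

text \<open>
  \<open>heat_semigroup X b m T\<close> says that \<open>T t = e\<^sup>-\<^sup>t\<^sup>L\<close> on \<open>l2 X m\<close> for all \<open>t \<ge> 0\<close>: \<open>T\<close> is the strongly
  continuous semigroup of self-adjoint contractions whose generator is \<open>-L\<close>.
  As \<open>L\<close> is self-adjoint and nonnegative, such a semigroup exists, and it is determined by
  its generator. Nothing is said about \<open>T t\<close> for \<open>t < 0\<close> or outside of \<open>l2 X m\<close>.
\<close>

definition heat_semigroup ::
    "'a set \<Rightarrow> ('a \<Rightarrow> 'a \<Rightarrow> real) \<Rightarrow> ('a \<Rightarrow> real) \<Rightarrow>
     (real \<Rightarrow> ('a \<Rightarrow> real) \<Rightarrow> ('a \<Rightarrow> real)) \<Rightarrow> bool" where
  "heat_semigroup X b m T \<longleftrightarrow>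
     (\<forall>t\<ge>0. \<forall>f\<in>l2 X m. T t f \<in> l2 X m) \<and>
     (\<forall>t\<ge>0. \<forall>f\<in>l2 X m. \<forall>g\<in>l2 X m. \<forall>c d.
        T t (\<lambda>x. c * f x + d * g x) = (\<lambda>x. c * T t f x + d * T t g x)) \<and>
     (\<forall>t\<ge>0. \<forall>f\<in>l2 X m. l2_norm X m (T t f) \<le> l2_norm X m f) \<and>
     (\<forall>t\<ge>0. \<forall>f\<in>l2 X m. \<forall>g\<in>l2 X m. l2_inner X m (T t f) g = l2_inner X m f (T t g)) \<and>
     (\<forall>f\<in>l2 X m. T 0 f = f) \<and>
     (\<forall>s\<ge>0. \<forall>t\<ge>0. \<forall>f\<in>l2 X m. T (s + t) f = T s (T t f)) \<and>
     (\<forall>f\<in>l2 X m. ((\<lambda>t. l2_norm X m (\<lambda>x. T t f x - f x)) \<longlongrightarrow> 0) (at_right 0)) \<and>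
     (\<forall>f\<in>l2 X m. \<forall>g\<in>l2 X m.
        (f, g) \<in> dirichlet_laplacian X b m \<longleftrightarrow>
        ((\<lambda>t. l2_norm X m (\<lambda>x. (f x - T t f x) / t - g x)) \<longlongrightarrow> 0) (at_right 0))"

text \<open>The quantifier over \<open>T\<close> only names the unique semigroup \<open>e\<^sup>-\<^sup>t\<^sup>L\<close>. The integrand is
  nonnegative because this semigroup is positivity preserving.\<close>

definition transient_graph :: "'a set \<Rightarrow> ('a \<Rightarrow> 'a \<Rightarrow> real) \<Rightarrow> ('a \<Rightarrow> real) \<Rightarrow> bool" where
  "transient_graph X b m \<longleftrightarrow>
     (\<forall>T. heat_semigroup X b m T \<longrightarrow>
        (\<exists>x\<in>X. \<exists>y\<in>X. (\<integral>\<^sup>+t\<in>{0..}. ennreal (T t (indicator {y}) x) \<partial>lborel) < \<infinity>))"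

definition recurrent_graph :: "'a set \<Rightarrow> ('a \<Rightarrow> 'a \<Rightarrow> real) \<Rightarrow> ('a \<Rightarrow> real) \<Rightarrow> bool" where
  "recurrent_graph X b m \<longleftrightarrow> \<not> transient_graph X b m"

definition densely_defined_operator :: "'a set \<Rightarrow> ('a \<Rightarrow> real) \<Rightarrow> 'a oper \<Rightarrow> bool" where
  "densely_defined_operator X m A \<longleftrightarrow>
     A \<subseteq> l2 X m \<times> l2 X m \<and> single_valued A \<and>
     (\<forall>f f' g g' c d. (f, f') \<in> A \<and> (g, g') \<in> A \<longrightarrow>
        (\<lambda>x. c * f x + d * g x, \<lambda>x. c * f' x + d * g' x) \<in> A) \<and>
     (\<forall>f\<in>l2 X m. \<forall>\<epsilon>>0. \<exists>g\<in>Domain A. l2_norm X m (\<lambda>x. f x - g x) < \<epsilon>)"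

definition adjoint_operator :: "'a set \<Rightarrow> ('a \<Rightarrow> real) \<Rightarrow> 'a oper \<Rightarrow> 'a oper" where
  "adjoint_operator X m A =
     {(g, h). g \<in> l2 X m \<and> h \<in> l2 X m \<and>
        (\<forall>(f, f') \<in> A. l2_inner X m f' g = l2_inner X m f h)}"

definition self_adjoint :: "'a set \<Rightarrow> ('a \<Rightarrow> real) \<Rightarrow> 'a oper \<Rightarrow> bool" where
  "self_adjoint X m A \<longleftrightarrow> densely_defined_operator X m A \<and> adjoint_operator X m A = A"

definition essentially_self_adjoint :: "'a set \<Rightarrow> ('a \<Rightarrow> real) \<Rightarrow> 'a oper \<Rightarrow> bool" where
  "essentially_self_adjoint X m A \<longleftrightarrow> (\<exists>!B. A \<subseteq> B \<and> self_adjoint X m B)"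

definition minimal_laplacian ::
    "'a set \<Rightarrow> ('a \<Rightarrow> 'a \<Rightarrow> real) \<Rightarrow> ('a \<Rightarrow> real) \<Rightarrow> 'a oper" where
  "minimal_laplacian X b m = {(f, laplacian X b m f) | f. f \<in> finitely_supported X}"

end

theory Submission
  imports Defs
begin

text \<open>
  Harmonic functions on \<open>\<int>\<close> have constant flux \<open>b x (x + 1) * (f (x + 1) - f x)\<close>, so on a ray they are affine
  functions of the resistance \<open>r k = (\<Sum>i<k. 1 / c i)\<close>, where \<open>c i\<close> are the successive edge weights.
  The Laplacian of a ray is essentially self-adjoint iff \<open>r\<close> is not square summable: if it is not, the
  Wronskian of any two functions in the domain of the adjoint tends to 0 (Weyl's limit point argument),
  so the adjoint is symmetric; if it is, the vanishing at infinity of the Wronskian with \<open>1\<close>, respectively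
  with \<open>r\<close>, gives two different self-adjoint extensions. Recurrence forces \<open>r\<close> to diverge on both rays, so
  that a nonconstant harmonic function is square summable iff \<open>r\<close> is so on both rays.

  For the divergence, let \<open>x\<close> be the first vertex of a ray with \<open>(\<Sum>i. 1 / c i) < \<infinity>\<close>. Then \<open>(u x)\<^sup>2 \<le> C * Q u\<close>
  on the form domain. Applied to \<open>u = (\<Sum>k<N. T (k + 1/2) 1\<^sub>x)\<close>, whose energy is at most \<open>\<langle>1\<^sub>x, \<Sum>k<N. T k 1\<^sub>x\<rangle>\<close>,
  this bounds \<open>\<Sum>k. \<langle>T k 1\<^sub>x, 1\<^sub>x\<rangle>\<close> and hence the integral of the decreasing function \<open>\<langle>T t 1\<^sub>x, 1\<^sub>x\<rangle>\<close>.
\<close>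

section \<open>Weighted square summable functions\<close>

locale weighted_set =
  fixes X :: "'a set" and m :: "'a \<Rightarrow> real"
  assumes m_pos: "x \<in> X \<Longrightarrow> m x > 0"
begin

abbreviation "L2 \<equiv> l2 X m"
abbreviation "ip \<equiv> l2_inner X m"
abbreviation "nrm \<equiv> l2_norm X m"

lemma l2D: "f \<in> L2 \<Longrightarrow> (\<lambda>x. (f x)\<^sup>2 * m x) summable_on X"
  by (simp add: l2_def)

lemma l2_mult_summable:
  assumes "f \<in> L2" "g \<in> L2"
  shows "(\<lambda>x. f x * g x * m x) summable_on X"
proof -
  have "(\<lambda>x. (f x)\<^sup>2 * m x + (g x)\<^sup>2 * m x) summable_on X"
    by (intro summable_on_add l2D assms)
  moreover have "norm (f x * g x * m x) \<le> (f x)\<^sup>2 * m x + (g x)\<^sup>2 * m x" if "x \<in> X" for x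
  proof -
    have "2 * (\<bar>f x\<bar> * \<bar>g x\<bar>) \<le> (f x)\<^sup>2 + (g x)\<^sup>2"
      using sum_squares_bound[of "\<bar>f x\<bar>" "\<bar>g x\<bar>"] by (simp add: mult.assoc)
    then have "\<bar>f x\<bar> * \<bar>g x\<bar> \<le> (f x)\<^sup>2 + (g x)\<^sup>2"
      using mult_nonneg_nonneg[of "\<bar>f x\<bar>" "\<bar>g x\<bar>"] by linarith
    then show ?thesis
      using mult_right_mono[of "\<bar>f x\<bar> * \<bar>g x\<bar>" "(f x)\<^sup>2 + (g x)\<^sup>2" "m x"] m_pos[OF that]
      by (simp add: abs_mult algebra_simps)
  qed
  ultimately have "(\<lambda>x. norm (f x * g x * m x)) summable_on X"
    by (rule summable_on_comparison_test) auto
  then show ?thesis by (rule abs_summable_summable)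
qed

lemma l2_lincomb:
  assumes "f \<in> L2" "g \<in> L2"
  shows "(\<lambda>x. c * f x + d * g x) \<in> L2"
proof -
  have "(\<lambda>x. c\<^sup>2 * ((f x)\<^sup>2 * m x) + (2 * c * d) * (f x * g x * m x) + d\<^sup>2 * ((g x)\<^sup>2 * m x)) summable_on X"
    by (intro summable_on_add summable_on_cmult_right l2_mult_summable l2D assms)
  also have "(\<lambda>x. c\<^sup>2 * ((f x)\<^sup>2 * m x) + (2 * c * d) * (f x * g x * m x) + d\<^sup>2 * ((g x)\<^sup>2 * m x))
     = (\<lambda>x. (c * f x + d * g x)\<^sup>2 * m x)"
    by (auto simp: power2_eq_square algebra_simps)
  finally show ?thesis using assms by (simp add: l2_def)
qed

lemma l2_add: "f \<in> L2 \<Longrightarrow> g \<in> L2 \<Longrightarrow> (\<lambda>x. f x + g x) \<in> L2"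
  using l2_lincomb[of f g 1 1] by simp

lemma l2_diff: "f \<in> L2 \<Longrightarrow> g \<in> L2 \<Longrightarrow> (\<lambda>x. f x - g x) \<in> L2"
  using l2_lincomb[of f g 1 "-1"] by simp

lemma l2_zero: "(\<lambda>x. 0) \<in> L2"
  by (simp add: l2_def)

lemma l2_finite_support:
  assumes "finite S" "S \<subseteq> X" "\<And>x. x \<notin> S \<Longrightarrow> f x = 0"
  shows "f \<in> L2"
proof -
  have "((\<lambda>x. (f x)\<^sup>2 * m x) has_sum (\<Sum>x\<in>S. (f x)\<^sup>2 * m x)) X"
    by (rule has_sum_finite_neutralI[OF assms(1,2)]) (use assms in auto)
  then show ?thesis using assms by (auto simp: l2_def summable_on_def)
qed

lemma finitely_supported_l2: "f \<in> finitely_supported X \<Longrightarrow> f \<in> L2"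
  by (rule l2_finite_support[of "{x. f x \<noteq> 0}"]) (auto simp: finitely_supported_def)

section \<open>Inner product, norm and Cauchy-Schwarz\<close>

lemma inner_commute: "ip f g = ip g f"
  by (simp add: l2_inner_def mult.commute)

lemma inner_lincomb_left:
  assumes "f \<in> L2" "g \<in> L2" "h \<in> L2"
  shows "ip (\<lambda>x. c * f x + d * g x) h = c * ip f h + d * ip g h"
proof -
  have "ip (\<lambda>x. c * f x + d * g x) h
      = (\<Sum>\<^sub>\<infinity>x\<in>X. c * (f x * h x * m x) + d * (g x * h x * m x))"
    unfolding l2_inner_def by (intro infsum_cong) (simp add: algebra_simps)
  also have "\<dots> = (\<Sum>\<^sub>\<infinity>x\<in>X. c * (f x * h x * m x)) + (\<Sum>\<^sub>\<infinity>x\<in>X. d * (g x * h x * m x))"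
    by (intro infsum_add summable_on_cmult_right l2_mult_summable assms)
  also have "\<dots> = c * ip f h + d * ip g h"
    unfolding l2_inner_def by (simp add: infsum_cmult_right')
  finally show ?thesis .
qed

lemma inner_lincomb_right:
  assumes "f \<in> L2" "g \<in> L2" "h \<in> L2"
  shows "ip h (\<lambda>x. c * f x + d * g x) = c * ip h f + d * ip h g"
  using inner_lincomb_left[OF assms] by (simp add: inner_commute)

lemma inner_add_left: "f \<in> L2 \<Longrightarrow> g \<in> L2 \<Longrightarrow> h \<in> L2 \<Longrightarrow> ip (\<lambda>x. f x + g x) h = ip f h + ip g h"
  using inner_lincomb_left[of f g h 1 1] by simp

lemma inner_diff_left: "f \<in> L2 \<Longrightarrow> g \<in> L2 \<Longrightarrow> h \<in> L2 \<Longrightarrow> ip (\<lambda>x. f x - g x) h = ip f h - ip g h"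
  using inner_lincomb_left[of f g h 1 "-1"] by simp

lemma inner_add_right: "f \<in> L2 \<Longrightarrow> g \<in> L2 \<Longrightarrow> h \<in> L2 \<Longrightarrow> ip h (\<lambda>x. f x + g x) = ip h f + ip h g"
  using inner_add_left[of f g h] by (simp add: inner_commute)

lemma inner_diff_right: "f \<in> L2 \<Longrightarrow> g \<in> L2 \<Longrightarrow> h \<in> L2 \<Longrightarrow> ip h (\<lambda>x. f x - g x) = ip h f - ip h g"
  using inner_diff_left[of f g h] by (simp add: inner_commute)

lemma l2_sum:
  assumes "\<And>i. i \<in> I \<Longrightarrow> F i \<in> L2"
  shows "(\<lambda>x. \<Sum>i\<in>I. F i x) \<in> L2"
  using assms by (induction I rule: infinite_finite_induct) (simp_all add: l2_zero l2_add)

lemma inner_sum_left: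
  assumes "\<And>i. i \<in> I \<Longrightarrow> F i \<in> L2" "h \<in> L2"
  shows "ip (\<lambda>x. \<Sum>i\<in>I. F i x) h = (\<Sum>i\<in>I. ip (F i) h)"
  using assms
proof (induction I rule: infinite_finite_induct)
  case (insert i I)
  then show ?case by (simp add: inner_add_left l2_sum)
qed (simp_all add: l2_inner_def)

lemma inner_sum_right:
  assumes "\<And>i. i \<in> I \<Longrightarrow> F i \<in> L2" "h \<in> L2"
  shows "ip h (\<lambda>x. \<Sum>i\<in>I. F i x) = (\<Sum>i\<in>I. ip h (F i))"
  using inner_sum_left[OF assms] by (simp add: inner_commute)

lemma inner_self_nonneg: "ip f f \<ge> 0"
  unfolding l2_inner_def using m_pos by (intro infsum_nonneg) (simp add: less_imp_le)

lemma norm_eq_sqrt_inner: "nrm f = sqrt (ip f f)"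
  by (simp add: l2_norm_def l2_inner_def power2_eq_square)

lemma norm_square: "(nrm f)\<^sup>2 = ip f f"
  by (simp add: norm_eq_sqrt_inner inner_self_nonneg)

lemma norm_nonneg: "nrm f \<ge> 0"
  by (simp add: norm_eq_sqrt_inner inner_self_nonneg)

lemma Cauchy_Schwarz:
  assumes "f \<in> L2" "g \<in> L2"
  shows "\<bar>ip f g\<bar> \<le> nrm f * nrm g"
proof -
  have q: "0 \<le> ip f f + 2 * t * ip f g + t\<^sup>2 * ip g g" for t
  proof -
    let ?h = "\<lambda>x. 1 * f x + t * g x"
    have "?h \<in> L2" by (intro l2_lincomb assms)
    then have "ip ?h ?h = 1 * (1 * ip f f + t * ip f g) + t * (1 * ip g f + t * ip g g)"
      using assms by (simp only: inner_lincomb_left inner_lincomb_right)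
    then show ?thesis using inner_self_nonneg[of ?h]
      by (simp add: inner_commute[of g f] power2_eq_square algebra_simps)
  qed
  have "(ip f g)\<^sup>2 \<le> ip f f * ip g g"
  proof (cases "ip g g = 0")
    case True
    have "ip f g = 0"
    proof (rule ccontr)
      assume "ip f g \<noteq> 0"
      then show False
        \<comment> \<open>With \<open>ip g g = 0\<close> the polynomial in \<open>q\<close> is
          affine in \<open>t\<close>, and this \<open>t\<close> gives it the value -1.\<close>
        using q[of "- (ip f f + 1) / (2 * ip f g)"] True by (simp add: field_simps)
    qed
    then show ?thesis using True by simp
  next
    case False
    then have pos: "ip g g > 0" using inner_self_nonneg[of g] by simp
    \<comment> \<open>The quadratic polynomial in \<open>q\<close> is evaluated at its
      minimum.\<close>
    have "0 \<le> ip f f - (ip f g)\<^sup>2 / ip g g"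
      using q[of "- ip f g / ip g g"] pos by (simp add: field_simps power2_eq_square)
    then show ?thesis using pos by (simp add: field_simps)
  qed
  then have "sqrt ((ip f g)\<^sup>2) \<le> sqrt (ip f f * ip g g)" by (rule real_sqrt_le_mono)
  then show ?thesis by (simp add: norm_eq_sqrt_inner real_sqrt_mult)
qed

lemma norm_add_le:
  assumes "f \<in> L2" "g \<in> L2"
  shows "nrm (\<lambda>x. f x + g x) \<le> nrm f + nrm g"
proof (rule power2_le_imp_le)
  let ?h = "\<lambda>x. f x + g x"
  have "?h \<in> L2" by (rule l2_add[OF assms])
  then have "ip ?h ?h = (ip f f + ip f g) + (ip g f + ip g g)"
    using assms by (simp only: inner_add_left inner_add_right)
  then have "(nrm ?h)\<^sup>2 = ip f f + 2 * ip f g + ip g g"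
    by (simp add: norm_square inner_commute[of g f])
  also have "\<dots> \<le> (nrm f + nrm g)\<^sup>2"
    using Cauchy_Schwarz[OF assms] by (simp add: power2_sum norm_square)
  finally show "(nrm (\<lambda>x. f x + g x))\<^sup>2 \<le> (nrm f + nrm g)\<^sup>2" .
qed (simp add: norm_nonneg)

lemma square_le_norm:
  assumes "f \<in> L2" "x \<in> X"
  shows "(f x)\<^sup>2 * m x \<le> (nrm f)\<^sup>2"
proof -
  have "(\<Sum>y\<in>{x}. (f y)\<^sup>2 * m y) \<le> (\<Sum>\<^sub>\<infinity>y\<in>X. (f y)\<^sup>2 * m y)"
    by (rule finite_sum_le_infsum[OF l2D]) (use assms m_pos in \<open>auto simp: less_imp_le\<close>)
  then show ?thesis by (simp add: norm_square) (simp add: l2_inner_def power2_eq_square)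
qed

lemma indicator_l2: "x \<in> X \<Longrightarrow> (indicator {x} :: 'a \<Rightarrow> real) \<in> L2"
  by (rule l2_finite_support[of "{x}"]) auto

lemma inner_finite_support:
  assumes "finite S" "S \<subseteq> X" "\<And>x. x \<notin> S \<Longrightarrow> f x = 0"
  shows "ip f g = (\<Sum>x\<in>S. f x * g x * m x)"
  unfolding l2_inner_def
  by (rule infsumI, rule has_sum_finite_neutralI[OF assms(1,2)]) (use assms in auto)

lemma inner_indicator: "x \<in> X \<Longrightarrow> ip (indicator {x}) g = g x * m x"
  by (subst inner_finite_support[of "{x}"]) auto

end

section \<open>Energy along a path of finite resistance\<close>

locale weighted_graph = weighted_set X m
  for X :: "'a set" and m :: "'a \<Rightarrow> real" +
  fixes b :: "'a \<Rightarrow> 'a \<Rightarrow> real"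
  assumes b_sym: "b x y = b y x"
    and b_nonneg: "b x y \<ge> 0"
    and locally_finite: "x \<in> X \<Longrightarrow> finite {y \<in> X. b x y \<noteq> 0}"
begin

text \<open>The energy sums over ordered pairs, so every edge meeting \<open>S\<close> occurs in
  both orientations. Those leaving \<open>S\<close> are finite in number by local finiteness, and
  symmetry of \<open>b\<close> reverses them into the others.\<close>

lemma finite_edges:
  assumes "finite S" "S \<subseteq> X"
  shows "finite {(x, y). x \<in> X \<and> y \<in> X \<and> b x y \<noteq> 0 \<and> (x \<in> S \<or> y \<in> S)}" (is "finite ?E")
proof -
  let ?A = "Sigma S (\<lambda>x. {y \<in> X. b x y \<noteq> 0})"
  have "finite (?A \<union> prod.swap ` ?A)"
    using assms locally_finite by (intro finite_UnI finite_imageI finite_SigmaI) auto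
  moreover have "?E \<subseteq> ?A \<union> prod.swap ` ?A"
    by (auto simp: b_sym image_iff)
  ultimately show ?thesis by (rule finite_subset[rotated])
qed

lemma energy_nonneg: "energy X b f \<ge> 0"
  unfolding energy_def by (intro divide_nonneg_pos infsum_nonneg) (auto simp: b_nonneg)

lemma finite_energy_finitely_supported:
  assumes "f \<in> finitely_supported X"
  shows "finite_energy X b f"
proof -
  let ?S = "{x. f x \<noteq> 0}"
  let ?E = "{(x, y). x \<in> X \<and> y \<in> X \<and> b x y \<noteq> 0 \<and> (x \<in> ?S \<or> y \<in> ?S)}"
  have "finite ?E" using assms by (intro finite_edges) (auto simp: finitely_supported_def)
  then have "((\<lambda>(x, y). b x y * (f x - f y)\<^sup>2) has_sum (\<Sum>(x, y)\<in>?E. b x y * (f x - f y)\<^sup>2)) (X \<times> X)"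
    by (rule has_sum_finite_neutralI) auto
  then show ?thesis by (auto simp: finite_energy_def summable_on_def)
qed

text \<open>Pointwise this is (r - s)^2 \<le> 2 r^2 + 2 s^2. The crude factor 2 suffices, since
  energies are only compared up to constants.\<close>

lemma
  assumes "finite_energy X b f" "finite_energy X b g"
  shows finite_energy_diff: "finite_energy X b (\<lambda>x. f x - g x)"
    and energy_diff_le: "energy X b (\<lambda>x. f x - g x) \<le> 2 * energy X b f + 2 * energy X b g"
proof -
  let ?e = "\<lambda>f (x, y). b x y * (f x - f y)\<^sup>2"
  have s: "(\<lambda>p. 2 * ?e f p + 2 * ?e g p) summable_on X \<times> X"
    using assms by (intro summable_on_add summable_on_cmult_right) (auto simp: finite_energy_def)
  have le: "?e (\<lambda>x. f x - g x) p \<le> 2 * ?e f p + 2 * ?e g p" for p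
  proof -
    have "(r - s)\<^sup>2 \<le> 2 * r\<^sup>2 + 2 * s\<^sup>2" for r s :: real
      using zero_le_power2[of "r + s"] by (simp add: power2_eq_square algebra_simps)
    then have "b x y * ((f x - f y) - (g x - g y))\<^sup>2
        \<le> b x y * (2 * (f x - f y)\<^sup>2 + 2 * (g x - g y)\<^sup>2)" for x y
      by (intro mult_left_mono b_nonneg)
    moreover have "(f x - f y) - (g x - g y) = (f x - g x) - (f y - g y)" for x y by simp
    ultimately show ?thesis
      by (cases p) (simp add: distrib_left mult.left_commute)
  qed
  show fd: "finite_energy X b (\<lambda>x. f x - g x)"
    unfolding finite_energy_def
    by (rule summable_on_comparison_test[OF s le]) (auto simp: b_nonneg)
  have "infsum (?e (\<lambda>x. f x - g x)) (X \<times> X) \<le> (\<Sum>\<^sub>\<infinity>p\<in>X \<times> X. 2 * ?e f p + 2 * ?e g p)"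
    by (rule infsum_mono[OF fd[unfolded finite_energy_def] s le])
  also have "\<dots> = 2 * infsum (?e f) (X \<times> X) + 2 * infsum (?e g) (X \<times> X)"
    using assms by (subst infsum_add) (auto simp: finite_energy_def infsum_cmult_right' intro!: summable_on_cmult_right)
  finally show "energy X b (\<lambda>x. f x - g x) \<le> 2 * energy X b f + 2 * energy X b g"
    by (simp add: energy_def)
qed

section \<open>Bounding point values by the energy\<close>

text \<open>Cauchy-Schwarz for the telescoping sum, with each increment split into
  \<open>1 / sqrt c\<close> times \<open>sqrt c\<close> times the increment. The path uses each edge
  in one orientation, so its part of the energy is bounded by the full sum over ordered pairs, which
  is twice \<open>energy\<close>.\<close>

lemma path_difference_le_energy:
  assumes v: "inj v" "\<And>k. v k \<in> X" "\<And>k. b (v k) (v (Suc k)) > 0"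
    and s: "summable (\<lambda>k. 1 / b (v k) (v (Suc k)))"
    and f: "finite_energy X b f"
  shows "(f (v 0) - f (v n))\<^sup>2 \<le> 2 * (\<Sum>k. 1 / b (v k) (v (Suc k))) * energy X b f"
proof -
  let ?c = "\<lambda>k. b (v k) (v (Suc k))"
  let ?e = "\<lambda>(x, y). b x y * (f x - f y)\<^sup>2"
  have c: "?c k > 0" for k by (rule v)
  have "f (v 0) - f (v n) = (\<Sum>k<n. f (v k) - f (v (Suc k)))"
    by (rule sum_lessThan_telescope'[symmetric])
  also have "\<dots> = (\<Sum>k<n. (1 / sqrt (?c k)) * (sqrt (?c k) * (f (v k) - f (v (Suc k)))))"
    by (intro sum.cong) (simp_all add: less_imp_neq[OF c, symmetric])
  also have "\<dots>\<^sup>2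
      \<le> (\<Sum>k<n. (1 / sqrt (?c k))\<^sup>2) * (\<Sum>k<n. (sqrt (?c k) * (f (v k) - f (v (Suc k))))\<^sup>2)"
    by (rule Cauchy_Schwarz_ineq_sum)
  also have "\<dots> = (\<Sum>k<n. 1 / ?c k) * (\<Sum>k<n. ?c k * (f (v k) - f (v (Suc k)))\<^sup>2)"
    by (simp add: power_divide power_mult_distrib b_nonneg)
  also have "\<dots> \<le> (\<Sum>k. 1 / ?c k) * (2 * energy X b f)"
  proof (rule mult_mono)
    show "(\<Sum>k<n. 1 / ?c k) \<le> (\<Sum>k. 1 / ?c k)"
      using s c by (intro sum_le_suminf) (auto simp: less_imp_le)
    have "(\<Sum>k<n. ?c k * (f (v k) - f (v (Suc k)))\<^sup>2) = (\<Sum>p\<in>(\<lambda>k. (v k, v (Suc k))) ` {..<n}. ?e p)"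
      using v(1) by (subst sum.reindex) (auto simp: inj_on_def)
    also have "\<dots> \<le> infsum ?e (X \<times> X)"
      using f v(2) by (intro finite_sum_le_infsum) (auto simp: finite_energy_def b_nonneg)
    finally show "(\<Sum>k<n. ?c k * (f (v k) - f (v (Suc k)))\<^sup>2) \<le> 2 * energy X b f"
      by (simp add: energy_def)
    show "0 \<le> (\<Sum>k. 1 / ?c k)" using s c by (intro suminf_nonneg) (auto simp: less_imp_le)
    show "0 \<le> (\<Sum>k<n. ?c k * (f (v k) - f (v (Suc k)))\<^sup>2)" by (intro sum_nonneg) (auto simp: b_nonneg)
  qed
  finally show ?thesis by (simp add: mult_ac)
qed

text \<open>A finitely supported function vanishes somewhere on the path, so the difference bound
  controls its value at \<open>v 0\<close>. Approximation in the form norm, which dominates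
  evaluation at \<open>v 0\<close>, carries this over to the whole form domain.\<close>

lemma path_end_le_energy:
  assumes v: "inj v" "\<And>k. v k \<in> X" "\<And>k. b (v k) (v (Suc k)) > 0"
    and s: "summable (\<lambda>k. 1 / b (v k) (v (Suc k)))"
    and f: "f \<in> dirichlet_domain X b m"
  shows "(f (v 0))\<^sup>2 \<le> 8 * (\<Sum>k. 1 / b (v k) (v (Suc k))) * energy X b f"
proof -
  let ?R = "\<Sum>k. 1 / b (v k) (v (Suc k))"
  have R: "?R \<ge> 0" using s v(3) by (intro suminf_nonneg) (auto simp: less_imp_le)
  from f obtain \<phi> :: "nat \<Rightarrow> 'a \<Rightarrow> real"
    where fL: "f \<in> L2" and fe: "finite_energy X b f" and \<phi>: "\<And>n. \<phi> n \<in> finitely_supported X"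
      and lim: "(\<lambda>n. sqrt ((nrm (\<lambda>x. f x - \<phi> n x))\<^sup>2 + energy X b (\<lambda>x. f x - \<phi> n x))) \<longlonglongrightarrow> 0"
    unfolding dirichlet_domain_def by auto
  define d where "d n = (nrm (\<lambda>x. f x - \<phi> n x))\<^sup>2 + energy X b (\<lambda>x. f x - \<phi> n x)" for n
  have d0: "0 \<le> d n" for n by (simp add: d_def energy_nonneg)
  have "(\<lambda>n. (sqrt (d n))\<^sup>2) \<longlonglongrightarrow> 0\<^sup>2" using lim unfolding d_def by (rule tendsto_power)
  then have d: "d \<longlonglongrightarrow> 0" using d0 by simp
  \<comment> \<open>\<open>K\<close> collects the two error terms of an approximation:
    \<open>8 * ?R\<close> for the energy of \<open>f - \<phi> n\<close>, and
    \<open>2 / m (v 0)\<close> for its squared norm.\<close>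
  define K where "K = 8 * ?R + 2 / m (v 0)"
  have bound: "(f (v 0))\<^sup>2 \<le> 8 * ?R * energy X b f + K * d n" for n
  proof -
    let ?g = "\<lambda>x. f x - \<phi> n x"
    have ge: "finite_energy X b ?g"
      by (rule finite_energy_diff[OF fe finite_energy_finitely_supported[OF \<phi>]])
    have "finite {k. \<phi> n (v k) \<noteq> 0}"
      using finite_vimageI[OF _ v(1), of "{x. \<phi> n x \<noteq> 0}"] \<phi>[of n]
      by (simp add: finitely_supported_def vimage_def)
    \<comment> \<open>The path is injective, hence leaves the finite support of
      \<open>\<phi> n\<close>.\<close>
    then obtain k where k: "\<phi> n (v k) = 0"
      using infinite_UNIV_nat ex_new_if_finite by blast
    have \<phi>_eq: "\<phi> n = (\<lambda>x. f x - ?g x)" by auto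
    have "energy X b (\<phi> n) \<le> 2 * energy X b f + 2 * energy X b ?g"
      using energy_diff_le[OF fe ge] \<phi>_eq by simp
    then have "2 * ?R * energy X b (\<phi> n) \<le> 2 * ?R * (2 * energy X b f + 2 * energy X b ?g)"
      using R by (intro mult_left_mono) auto
    with path_difference_le_energy[OF v s finite_energy_finitely_supported[OF \<phi>], of n k] k
    have 1: "(\<phi> n (v 0))\<^sup>2 \<le> 2 * ?R * (2 * energy X b f + 2 * energy X b ?g)" by simp
    have "?g \<in> L2" by (intro l2_diff fL finitely_supported_l2 \<phi>)
    from square_le_norm[OF this v(2), of 0] m_pos[OF v(2), of 0]
    have 2: "(?g (v 0))\<^sup>2 \<le> (nrm ?g)\<^sup>2 / m (v 0)" by (simp add: field_simps)
    have "(f (v 0))\<^sup>2 \<le> 2 * (\<phi> n (v 0))\<^sup>2 + 2 * (?g (v 0))\<^sup>2"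
      using zero_le_power2[of "\<phi> n (v 0) - ?g (v 0)"] by (simp add: power2_eq_square algebra_simps)
    also have "\<dots> \<le> 8 * ?R * energy X b f + 8 * ?R * energy X b ?g + 2 / m (v 0) * (nrm ?g)\<^sup>2"
      using 1 2 by (simp add: algebra_simps)
    also have "\<dots> \<le> 8 * ?R * energy X b f + K * d n"
      using mult_nonneg_nonneg[OF R zero_le_power2[of "nrm ?g"]] energy_nonneg[of ?g] m_pos[OF v(2), of 0]
      by (simp add: K_def d_def algebra_simps)
    finally show ?thesis .
  qed
  have "(\<lambda>n. 8 * ?R * energy X b f + K * d n) \<longlonglongrightarrow> 8 * ?R * energy X b f + K * 0"
    by (intro tendsto_intros d)
  from LIMSEQ_le_const[OF this] bound show ?thesis by auto
qed

section \<open>The point mass in the domain of the Dirichlet Laplacian\<close>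

lemma laplacian_finite_sum:
  assumes "x \<in> X"
  shows "laplacian X b m f x * m x = (\<Sum>y\<in>{y \<in> X. b x y \<noteq> 0}. b x y * (f x - f y))"
proof -
  have "(\<Sum>\<^sub>\<infinity>y\<in>X. b x y * (f x - f y)) = (\<Sum>y\<in>{y \<in> X. b x y \<noteq> 0}. b x y * (f x - f y))"
    by (rule infsumI, rule has_sum_finite_neutralI[OF locally_finite[OF assms]]) auto
  then show ?thesis using assms m_pos[OF assms] by (simp add: laplacian_def)
qed

text \<open>Having \<open>indicator {x}\<close> itself in the domain of L puts its whole heat orbit
  there, so no smoothing property of the semigroup has to be established.\<close>

lemma indicator_in_dirichlet_laplacian:
  assumes x: "x \<in> X"
  shows "(indicator {x}, laplacian X b m (indicator {x})) \<in> dirichlet_laplacian X b m"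
proof -
  let ?i = "indicator {x} :: 'a \<Rightarrow> real" and ?N = "{y \<in> X. b x y \<noteq> 0}"
  let ?L = "laplacian X b m ?i"
  have fs: "?i \<in> finitely_supported X" using x by (auto simp: finitely_supported_def indicator_def)
  have "?i \<in> dirichlet_domain X b m"
    unfolding dirichlet_domain_def
    by (intro CollectI conjI indicator_l2 x finite_energy_finitely_supported fs
        exI[of _ "\<lambda>_. ?i"]) (auto simp: fs l2_norm_def energy_def case_prod_unfold)
  moreover have fN: "finite (insert x ?N)" and Ns: "insert x ?N \<subseteq> X"
    using locally_finite[OF x] x by auto
  have L0: "?L y = 0" if "y \<notin> insert x ?N" for y
    using that b_sym[of x y] by (auto simp: laplacian_def indicator_def intro!: infsum_0)
  have Ly: "?L y * m y = - b x y" if "y \<in> X" "y \<noteq> x" for y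
  proof -
    have "(\<Sum>\<^sub>\<infinity>z\<in>X. b y z * (?i y - ?i z)) = (\<Sum>z\<in>{x}. b y z * (?i y - ?i z))"
      by (rule infsumI, rule has_sum_finite_neutralI[where B = "{x}"]) (use that x in auto)
    then show ?thesis using that m_pos[OF that(1)] by (simp add: laplacian_def b_sym[of y x])
  qed
  have Lx: "?L x * m x = (\<Sum>y\<in>?N - {x}. b x y)"
  proof -
    have "?L x * m x = (\<Sum>y\<in>?N. b x y * (1 - ?i y))"
      using laplacian_finite_sum[OF x, of ?i] by simp
    also have "\<dots> = (\<Sum>y\<in>?N - {x}. b x y)"
      using locally_finite[OF x] by (intro sum.mono_neutral_cong_right) auto
    finally show ?thesis .
  qed
  have "?L \<in> L2" by (rule l2_finite_support[OF fN Ns L0])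
  moreover have "energy_form X b ?i h = ip ?L h" for h
  proof -
    let ?F = "\<lambda>(y, z). b y z * (?i y - ?i z) * (h y - h z)"
    \<comment> \<open>A loop weight \<open>b x x\<close> may be nonzero here but contributes
      nothing, so \<open>x\<close> is removed from its neighbours. The remaining edges occur in both
      orientations with equal contributions, which cancels the 1/2 in the form.\<close>
    let ?M = "?N - {x}"
    have fM: "finite ?M" using fN by simp
    have "(\<Sum>\<^sub>\<infinity>p\<in>X \<times> X. ?F p) = (\<Sum>p\<in>Pair x ` ?M \<union> (\<lambda>y. (y, x)) ` ?M. ?F p)"
      by (rule infsumI, rule has_sum_finite_neutralI)
        (use fM x b_sym in \<open>auto simp: indicator_def split: if_splits\<close>)
    also have "\<dots> = (\<Sum>p\<in>Pair x ` ?M. ?F p) + (\<Sum>p\<in>(\<lambda>y. (y, x)) ` ?M. ?F p)"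
      using fM by (intro sum.union_disjoint) auto
    also have "\<dots> = (\<Sum>y\<in>?M. b x y * (h x - h y)) + (\<Sum>y\<in>?M. b x y * (h x - h y))"
    proof (intro arg_cong2[of _ _ _ _ "(+)"])
      show "(\<Sum>p\<in>Pair x ` ?M. ?F p) = (\<Sum>y\<in>?M. b x y * (h x - h y))"
        by (subst sum.reindex) (auto simp: inj_on_def)
      have "?F (y, x) = b x y * (h x - h y)" if "y \<in> ?M" for y
        using that b_sym[of y x] by (auto simp: algebra_simps)
      then show "(\<Sum>p\<in>(\<lambda>y. (y, x)) ` ?M. ?F p) = (\<Sum>y\<in>?M. b x y * (h x - h y))"
        by (subst sum.reindex) (auto simp: inj_on_def intro!: sum.cong)
    qed
    finally have 1: "energy_form X b ?i h = (\<Sum>y\<in>?M. b x y * (h x - h y))"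
      by (simp add: energy_form_def)
    have "ip ?L h = (\<Sum>y\<in>insert x ?M. ?L y * h y * m y)"
      by (subst inner_finite_support[OF fN Ns L0]) (auto intro!: sum.cong)
    also have "\<dots> = (?L x * m x) * h x + (\<Sum>y\<in>?M. (?L y * m y) * h y)"
      using fM by (subst sum.insert) (auto simp: mult_ac)
    also have "\<dots> = (\<Sum>y\<in>?M. b x y) * h x + (\<Sum>y\<in>?M. - b x y * h y)"
      unfolding Lx by (intro arg_cong2[of _ _ _ _ "(+)"] sum.cong) (auto simp: Ly)
    also have "\<dots> = (\<Sum>y\<in>?M. b x y * (h x - h y))"
      by (simp add: sum_distrib_right right_diff_distrib sum_subtractf sum_negf)
    finally show ?thesis using 1 by simp
  qed
  ultimately show ?thesis using indicator_l2[OF x] by (simp add: dirichlet_laplacian_def)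
qed

end

section \<open>Recurrence and divergent resistance\<close>

lemma tendsto_0_at_right_mono:
  fixes F G :: "real \<Rightarrow> real"
  assumes "(G \<longlongrightarrow> 0) (at_right 0)" "\<And>t. 0 \<le> F t" "\<And>t. t > 0 \<Longrightarrow> F t \<le> G t"
  shows "(F \<longlongrightarrow> 0) (at_right 0)"
  by (rule tendsto_sandwich[OF _ _ tendsto_const assms(1)])
    (use assms(2,3) in \<open>auto intro!: eventually_at_rightI[of 0 1]\<close>)

locale heat_flow = weighted_graph X m b
  for X :: "'a set" and m :: "'a \<Rightarrow> real" and b :: "'a \<Rightarrow> 'a \<Rightarrow> real" +
  fixes T :: "real \<Rightarrow> ('a \<Rightarrow> real) \<Rightarrow> ('a \<Rightarrow> real)"
  assumes heat: "heat_semigroup X b m T"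
begin

abbreviation "DL \<equiv> dirichlet_laplacian X b m"

section \<open>The semigroup and the domain of its generator\<close>

lemmas heat_props = heat[unfolded heat_semigroup_def]

lemma T_l2: "t \<ge> 0 \<Longrightarrow> f \<in> L2 \<Longrightarrow> T t f \<in> L2"
  by (rule heat_props[THEN conjunct1, rule_format])

lemma T_lincomb: 
  "t \<ge> 0 \<Longrightarrow> f \<in> L2 \<Longrightarrow> g \<in> L2 \<Longrightarrow> T t (\<lambda>x. c * f x + d * g x) = (\<lambda>x. c * T t f x + d * T t g x)"
  by (rule heat_props[THEN conjunct2, THEN conjunct1, rule_format])

lemma T_contraction: "t \<ge> 0 \<Longrightarrow> f \<in> L2 \<Longrightarrow> nrm (T t f) \<le> nrm f"
  by (rule heat_props[THEN conjunct2, THEN conjunct2, THEN conjunct1, rule_format])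

lemma T_symmetric: "t \<ge> 0 \<Longrightarrow> f \<in> L2 \<Longrightarrow> g \<in> L2 \<Longrightarrow> ip (T t f) g = ip f (T t g)"
  by (rule heat_props[THEN conjunct2, THEN conjunct2, THEN conjunct2, THEN conjunct1, rule_format])

lemma T_0: "f \<in> L2 \<Longrightarrow> T 0 f = f"
  by (rule heat_props[THEN conjunct2, THEN conjunct2, THEN conjunct2, THEN conjunct2, THEN conjunct1, rule_format])

lemma T_add: "s \<ge> 0 \<Longrightarrow> t \<ge> 0 \<Longrightarrow> f \<in> L2 \<Longrightarrow> T s (T t f) = T (s + t) f"
  by (rule heat_props[THEN conjunct2, THEN conjunct2, THEN conjunct2, THEN conjunct2, THEN conjunct2, THEN conjunct1, rule_format, symmetric])

lemma generator: "f \<in> L2 \<Longrightarrow> g \<in> L2 \<Longrightarrow> (f, g) \<in> DL \<longleftrightarrow>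
    ((\<lambda>t. nrm (\<lambda>x. (f x - T t f x) / t - g x)) \<longlongrightarrow> 0) (at_right 0)"
  by (rule heat_props[THEN conjunct2, THEN conjunct2, THEN conjunct2, THEN conjunct2, THEN conjunct2, THEN conjunct2, THEN conjunct2, rule_format])

lemma DL_l2: "(f, g) \<in> DL \<Longrightarrow> f \<in> L2" "(f, g) \<in> DL \<Longrightarrow> g \<in> L2"
  by (auto simp: dirichlet_laplacian_def dirichlet_domain_def)

lemma T_sum:
  assumes "t \<ge> 0" "\<And>i. i \<in> I \<Longrightarrow> F i \<in> L2"
  shows "T t (\<lambda>x. \<Sum>i\<in>I. F i x) = (\<lambda>x. \<Sum>i\<in>I. T t (F i) x)"
proof -
  have z: "T t (\<lambda>x. 0) = (\<lambda>x. 0)"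
    using T_lincomb[OF assms(1) l2_zero l2_zero, of 0 0] by simp
  show ?thesis using assms(2)
  proof (induction I rule: infinite_finite_induct)
    case (insert i I)
    then show ?case
      using T_lincomb[OF assms(1), of "F i" "\<lambda>x. \<Sum>i\<in>I. F i x" 1 1] by (simp add: l2_sum)
  qed (simp_all add: z)
qed

lemma difference_quotient_l2:
  assumes "f \<in> L2" "g \<in> L2" "t \<ge> 0"
  shows "(\<lambda>x. (f x - T t f x) / t - g x) \<in> L2"
  using l2_lincomb[OF l2_diff[OF assms(1) T_l2[OF assms(3,1)]] assms(2), of "1 / t" "-1"] by simp

text \<open>\<open>T s\<close> commutes with the semigroup, so it maps the difference quotients of
  \<open>f\<close> to those of \<open>T s f\<close>; being a contraction, it preserves their
  convergence.\<close>

lemma DL_T: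
  assumes fg: "(f, g) \<in> DL" and s: "s \<ge> 0"
  shows "(T s f, T s g) \<in> DL"
proof -
  have f: "f \<in> L2" and g: "g \<in> L2" using DL_l2 fg by auto
  have "((\<lambda>t. nrm (\<lambda>x. (f x - T t f x) / t - g x)) \<longlongrightarrow> 0) (at_right 0)"
    using generator[OF f g] fg by simp
  moreover have "nrm (\<lambda>x. (T s f x - T t (T s f) x) / t - T s g x)
      \<le> nrm (\<lambda>x. (f x - T t f x) / t - g x)" if t: "t > 0" for t
  proof -
    have d: "(\<lambda>x. f x - T t f x) \<in> L2" using f t by (intro l2_diff T_l2) auto
    have "T s (\<lambda>x. (1 / t) * (f x - T t f x) + (-1) * g x)
       = (\<lambda>x. (1 / t) * T s (\<lambda>x. 1 * f x + (-1) * T t f x) x + (-1) * T s g x)"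
      using T_lincomb[OF s d g, of "1 / t" "-1"] by simp
    also have "\<dots> = (\<lambda>x. (1 / t) * (1 * T s f x + (-1) * T s (T t f) x) + (-1) * T s g x)"
      using f t by (subst T_lincomb[OF s]) (auto intro: T_l2)
    also have "T s (T t f) = T t (T s f)"
      using s t f by (simp add: T_add add.commute)
    finally have "T s (\<lambda>x. (f x - T t f x) / t - g x) = (\<lambda>x. (T s f x - T t (T s f) x) / t - T s g x)"
      by simp
    with T_contraction[OF s difference_quotient_l2[OF f g, of t]] t show ?thesis by simp
  qed
  ultimately
  have "((\<lambda>t. nrm (\<lambda>x. (T s f x - T t (T s f) x) / t - T s g x)) \<longlongrightarrow> 0) (at_right 0)"
    by (rule tendsto_0_at_right_mono[OF _ norm_nonneg])
  then show ?thesis using generator[OF T_l2[OF s f] T_l2[OF s g]] by simp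
qed

text \<open>Additivity is read off the difference quotients through \<open>generator\<close>; the
  form side would first require that the form domain is closed under sums.\<close>

lemma DL_add:
  assumes fg: "(f, g) \<in> DL" and fg': "(f', g') \<in> DL"
  shows "(\<lambda>x. f x + f' x, \<lambda>x. g x + g' x) \<in> DL"
proof -
  have l: "f \<in> L2" "g \<in> L2" "f' \<in> L2" "g' \<in> L2" using DL_l2 fg fg' by auto
  let ?F = "\<lambda>f g t. nrm (\<lambda>x. (f x - T t f x) / t - g x)"
  have "((\<lambda>t. ?F f g t + ?F f' g' t) \<longlongrightarrow> 0 + 0) (at_right 0)"
    using generator[OF l(1,2)] generator[OF l(3,4)] fg fg' by (intro tendsto_add) auto
  moreover have "?F (\<lambda>x. f x + f' x) (\<lambda>x. g x + g' x) t \<le> ?F f g t + ?F f' g' t" if t: "t > 0" for t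
  proof -
    have "T t (\<lambda>x. f x + f' x) = (\<lambda>x. T t f x + T t f' x)"
      using T_lincomb[of t f f' 1 1] t l by simp
    then have "(\<lambda>x. (f x + f' x - T t (\<lambda>x. f x + f' x) x) / t - (g x + g' x))
       = (\<lambda>x. ((f x - T t f x) / t - g x) + ((f' x - T t f' x) / t - g' x))"
      by (simp add: add_divide_distrib diff_divide_distrib fun_eq_iff)
    then show ?thesis
      using norm_add_le[OF difference_quotient_l2[OF l(1,2), of t] difference_quotient_l2[OF l(3,4), of t]] t
      by simp
  qed
  ultimately have "(?F (\<lambda>x. f x + f' x) (\<lambda>x. g x + g' x) \<longlongrightarrow> 0) (at_right 0)"
    unfolding add_0_left by (rule tendsto_0_at_right_mono[OF _ norm_nonneg])
  then show ?thesis using generator[OF l2_add l2_add] l by simp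
qed

lemma DL_sum:
  assumes "finite I" "I \<noteq> {}" "\<And>i. i \<in> I \<Longrightarrow> (F i, G i) \<in> DL"
  shows "(\<lambda>x. \<Sum>i\<in>I. F i x, \<lambda>x. \<Sum>i\<in>I. G i x) \<in> DL"
  using assms by (induction I rule: finite_ne_induct) (auto intro: DL_add)

section \<open>Monotonicity and convexity of \<open>ip (T t w) w\<close> in \<open>t\<close>\<close>

lemma inner_T_T:
  assumes "w \<in> L2" "s \<ge> 0" "t \<ge> 0"
  shows "ip (T s w) (T t w) = ip (T (s + t) w) w"
  using T_symmetric[of t "T s w" w] assms by (simp add: T_l2 T_add add.commute)

lemma inner_T_nonneg: "w \<in> L2 \<Longrightarrow> t \<ge> 0 \<Longrightarrow> ip (T t w) w \<ge> 0"
  using inner_T_T[of w "t / 2" "t / 2"] inner_self_nonneg[of "T (t / 2) w"] by simp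

text \<open>By \<open>inner_T_T\<close> the quantity is the squared norm of
  \<open>T (t / 2) w\<close>, which contractivity makes decreasing.\<close>

lemma inner_T_antimono:
  assumes "w \<in> L2" "0 \<le> s" "s \<le> t"
  shows "ip (T t w) w \<le> ip (T s w) w"
proof -
  have "T ((t - s) / 2) (T (s / 2) w) = T (t / 2) w"
    using assms by (simp add: T_add add_divide_distrib[symmetric])
  then have "nrm (T (t / 2) w) \<le> nrm (T (s / 2) w)"
    using T_contraction[of "(t - s) / 2" "T (s / 2) w"] assms by (simp add: T_l2)
  then have "(nrm (T (t / 2) w))\<^sup>2 \<le> (nrm (T (s / 2) w))\<^sup>2"
    by (intro power_mono norm_nonneg)
  then show ?thesis
    using inner_T_T[of w "t / 2" "t / 2"] inner_T_T[of w "s / 2" "s / 2"] assms by (simp add: norm_square)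
qed

text \<open>The second difference is the squared norm of
  \<open>T (a / 2) w - T (a / 2 + d) w\<close>.\<close>

lemma inner_T_midpoint_convex:
  assumes w: "w \<in> L2" and a: "a \<ge> 0" and d: "d \<ge> 0"
  shows "ip (T (a + d) w) w - ip (T (a + 2 * d) w) w \<le> ip (T a w) w - ip (T (a + d) w) w"
proof -
  let ?g = "T (a / 2) w" and ?h = "T (a / 2 + d) w"
  have l: "?g \<in> L2" "?h \<in> L2" using w a d by (auto intro!: T_l2)
  have "ip (\<lambda>x. ?g x - ?h x) (\<lambda>x. ?g x - ?h x) = (ip ?g ?g - ip ?g ?h) - (ip ?h ?g - ip ?h ?h)"
    using l l2_diff[OF l] by (simp only: inner_diff_left inner_diff_right)
  also have "\<dots> = ip (T a w) w - 2 * ip (T (a + d) w) w + ip (T (a + 2 * d) w) w"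
    using w a d by (simp add: inner_T_T add_ac)
  finally show ?thesis using inner_self_nonneg[of "\<lambda>x. ?g x - ?h x"] by simp
qed

text \<open>On the grid of mesh 1/n the decrements \<open>D k\<close> decrease by convexity. So n
  times the decrement just after time 1 is at most the sum of the n decrements before it, the total
  drop on [0, 1].\<close>

lemma inner_T_difference_quotient:
  assumes w: "w \<in> L2" and n: "n > 0"
  shows "real n * (ip (T 1 w) w - ip (T (1 + 1 / real n) w) w) \<le> ip w w - ip (T 1 w) w"
proof -
  define r where "r t = ip (T t w) w" for t
  define D where "D k = r (real k / n) - r (real (Suc k) / n)" for k
  have "D (Suc k) \<le> D k" for k
    using inner_T_midpoint_convex[OF w, of "real k / n" "1 / n"]
    by (simp add: D_def r_def add_divide_distrib add_ac)
  then have "D n \<le> D k" if "k \<le> n" for k using that by (rule lift_Suc_antimono_le)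
  then have "(\<Sum>k<n. D n) \<le> (\<Sum>k<n. D k)" by (intro sum_mono) auto
  also have "\<dots> = r (real 0 / n) - r (real n / n)"
    unfolding D_def by (rule sum_lessThan_telescope')
  finally show ?thesis using n w by (simp add: D_def r_def T_0 add_divide_distrib add_ac)
qed

text \<open>On the spectral side this is \<open>x exp (-x) \<le> 1 - exp (-x)\<close>; it replaces integration of the
  semigroup.\<close>

lemma energy_T_half_le:
  assumes w: "w \<in> L2" and u: "(T (1/2) w, g) \<in> DL"
  shows "energy X b (T (1/2) w) \<le> ip w w - ip (T 1 w) w"
proof -
  let ?u = "T (1/2) w"
  have l: "?u \<in> L2" "g \<in> L2" using DL_l2 u by auto
  define F where "F t = nrm (\<lambda>x. (?u x - T t ?u x) / t - g x)" for t
  \<comment> \<open>Times of the form 1/n, since the bound on difference quotients is available on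
    such grids.\<close>
  define \<tau> where "\<tau> n = 1 / real (Suc n)" for n
  have \<tau>: "\<tau> n > 0" for n by (simp add: \<tau>_def)
  have "(F \<longlongrightarrow> 0) (at_right 0)" using generator[OF l] u by (simp add: F_def[abs_def])
  moreover have "filterlim \<tau> (at_right 0) sequentially"
    using LIMSEQ_inverse_real_of_nat \<tau> by (auto simp: filterlim_at \<tau>_def[abs_def] inverse_eq_divide)
  ultimately have "(\<lambda>n. F (\<tau> n)) \<longlonglongrightarrow> 0" by (rule filterlim_compose)
  then have lim: "(\<lambda>n. (ip w w - ip (T 1 w) w) + F (\<tau> n) * nrm ?u) \<longlonglongrightarrow> (ip w w - ip (T 1 w) w) + 0 * nrm ?u"
    by (intro tendsto_intros)
  have "ip g ?u \<le> (ip w w - ip (T 1 w) w) + F (\<tau> n) * nrm ?u" for n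
  proof -
    have t: "\<tau> n \<ge> 0" using \<tau>[of n] by simp
    let ?q = "\<lambda>x. (?u x - T (\<tau> n) ?u x) / \<tau> n - g x"
    have "ip ?q ?u = ip (\<lambda>x. (1 / \<tau> n) * (?u x - T (\<tau> n) ?u x) + (-1) * g x) ?u" by simp
    also have "\<dots> = (1 / \<tau> n) * ip (\<lambda>x. ?u x - T (\<tau> n) ?u x) ?u + (-1) * ip g ?u"
      by (intro inner_lincomb_left l2_diff l T_l2 t)
    also have "ip (\<lambda>x. ?u x - T (\<tau> n) ?u x) ?u = ip ?u ?u - ip (T (\<tau> n) ?u) ?u"
      by (intro inner_diff_left l T_l2 t)
    \<comment> \<open>The two half units of time in \<open>?u\<close> add up to 1, which is why the
      orbit is evaluated at 1/2.\<close>
    also have "\<dots> = ip (T 1 w) w - ip (T (1 + \<tau> n) w) w"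
      using w t by (simp add: T_add inner_T_T add_ac)
    finally have "ip g ?u = (1 / \<tau> n) * (ip (T 1 w) w - ip (T (1 + \<tau> n) w) w) - ip ?q ?u"
      by simp
    moreover have "(1 / \<tau> n) * (ip (T 1 w) w - ip (T (1 + \<tau> n) w) w) \<le> ip w w - ip (T 1 w) w"
      using inner_T_difference_quotient[OF w, of "Suc n"] by (simp add: \<tau>_def)
    moreover have "- ip ?q ?u \<le> F (\<tau> n) * nrm ?u"
      using Cauchy_Schwarz[OF difference_quotient_l2[OF l t] l(1)] by (simp add: F_def)
    ultimately show ?thesis by simp
  qed
  with LIMSEQ_le_const[OF lim] have "ip g ?u \<le> ip w w - ip (T 1 w) w" by auto
  \<comment> \<open>The defining identity of L, tested with \<open>?u\<close> itself.\<close>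
  moreover have "energy X b ?u = ip g ?u"
    using u by (auto simp: dirichlet_laplacian_def energy_def energy_form_def power2_eq_square mult.assoc)
  ultimately show ?thesis by simp
qed

section \<open>Finite resistance forces a finite Green function\<close>

text \<open>Let \<open>S\<close> be the sum of \<open>p\<close> over the first N half-integer times.
  It is \<open>m (v 0)\<close> times the value at \<open>v 0\<close> of \<open>T (1/2) w\<close>,
  whose energy is at most \<open>p 0 + S\<close>. The resistance bound is thus quadratic in
  \<open>S\<close> on the left and linear on the right, which bounds \<open>S\<close> independently
  of N.\<close>

lemma summable_heat_kernel:
  assumes v: "inj v" "\<And>k. v k \<in> X" "\<And>k. b (v k) (v (Suc k)) > 0"
    and s: "summable (\<lambda>k. 1 / b (v k) (v (Suc k)))"
  shows "summable (\<lambda>k. ip (T (real k) (indicator {v 0})) (indicator {v 0}))"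
proof -
  let ?i = "indicator {v 0} :: 'a \<Rightarrow> real" and ?L = "laplacian X b m (indicator {v 0})"
  let ?R = "\<Sum>k. 1 / b (v k) (v (Suc k))"
  define p where "p t = ip (T t ?i) ?i" for t
  have i: "?i \<in> L2" by (rule indicator_l2[OF v(2)])
  have iDL: "(?i, ?L) \<in> DL" by (rule indicator_in_dirichlet_laplacian[OF v(2)])
  have p0: "p t \<ge> 0" if "t \<ge> 0" for t using inner_T_nonneg[OF i that] by (simp add: p_def)
  have p_mono: "p t \<le> p s" if "0 \<le> s" "s \<le> t" for s t using inner_T_antimono[OF i that] by (simp add: p_def)
  have R: "?R \<ge> 0" using s v(3) by (intro suminf_nonneg) (auto simp: less_imp_le)
  define K where "K = 8 * ?R * (m (v 0))\<^sup>2"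
  have K: "K \<ge> 0" using R by (simp add: K_def)
  have bound: "(\<Sum>k<N. p (real k)) \<le> K + 2 * p 0" for N
  proof (cases "N = 0")
    case True
    then show ?thesis using K p0[of 0] by simp
  next
    case False
    define w where "w = (\<lambda>x. \<Sum>k<N. T (real k) ?i x)"
    define S where "S = (\<Sum>k<N. p (real k + 1/2))"
    have w: "w \<in> L2" unfolding w_def by (intro l2_sum T_l2 i) auto
    have T_w: "T t w = (\<lambda>x. \<Sum>k<N. T (real k + t) ?i x)" if "t \<ge> 0" for t
      unfolding w_def using that i by (subst T_sum) (auto intro: T_l2 simp: T_add add.commute)
    have "(\<lambda>x. \<Sum>k<N. T (real k + 1/2) ?i x, \<lambda>x. \<Sum>k<N. T (real k + 1/2) ?L x) \<in> DL"
      using False iDL by (intro DL_sum DL_T) auto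
    then have u: "(T (1/2) w, \<lambda>x. \<Sum>k<N. T (real k + 1/2) ?L x) \<in> DL" by (simp add: T_w)
    have "ip w w - ip (T 1 w) w = (\<Sum>k<N. ip (T (real k) ?i) w) - (\<Sum>k<N. ip (T (real k + 1) ?i) w)"
    proof -
      have "ip w w = (\<Sum>k<N. ip (T (real k) ?i) w)"
        by (subst w_def, rule inner_sum_left) (auto intro!: T_l2 i w)
      moreover have "ip (T 1 w) w = (\<Sum>k<N. ip (T (real k + 1) ?i) w)"
        by (subst T_w, simp, rule inner_sum_left) (auto intro!: T_l2 i w)
      ultimately show ?thesis by simp
    qed
    \<comment> \<open>Only the left slot is expanded while \<open>w\<close> is kept on the right, so
      the sum telescopes and no double sum arises.\<close>
    also have "\<dots> = ip (T (real 0) ?i) w - ip (T (real N) ?i) w"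
      using sum_lessThan_telescope'[of "\<lambda>k. ip (T (real k) ?i) w" N] by (simp add: sum_subtractf add.commute)
    also have "ip (T (real N) ?i) w = (\<Sum>k<N. p (real N + real k))"
      unfolding w_def p_def by (subst inner_sum_right) (auto intro!: T_l2 i sum.cong inner_T_T)
    also have "ip (T (real 0) ?i) w = (\<Sum>k<N. p (real k))"
      unfolding w_def p_def by (subst inner_sum_right)
        (auto intro!: T_l2 i sum.cong simp: T_0 i inner_commute[of ?i])
    finally have "ip w w - ip (T 1 w) w \<le> (\<Sum>k<N. p (real k))"
      using sum_nonneg[of "{..<N}" "\<lambda>k. p (real N + real k)"] p0 by auto
    \<comment> \<open>As \<open>p\<close> decreases, \<open>p (k + 1)\<close> is at most
      \<open>p (k + 1/2)\<close>; only the term \<open>p 0\<close> is left over.\<close>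
    also have "(\<Sum>k<N. p (real k)) \<le> p 0 + S"
    proof -
      obtain M where M: "N = Suc M" using False by (cases N) auto
      have "(\<Sum>k<N. p (real k)) = p 0 + (\<Sum>k<M. p (real k + 1))"
        unfolding M by (subst sum.lessThan_Suc_shift) (simp add: add.commute)
      also have "\<dots> \<le> p 0 + (\<Sum>k<M. p (real k + 1/2))"
        by (intro add_left_mono sum_mono p_mono) auto
      also have "\<dots> \<le> p 0 + S" unfolding S_def M using p0[of "real M + 1/2"] by simp
      finally show ?thesis .
    qed
    finally have "ip w w - ip (T 1 w) w \<le> p 0 + S" .
    with energy_T_half_le[OF w u] have e: "energy X b (T (1/2) w) \<le> p 0 + S" by simp
    have "T (1/2) w (v 0) * m (v 0) = ip ?i (T (1/2) w)" by (simp add: inner_indicator[OF v(2)])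
    also have "\<dots> = S"
      unfolding S_def p_def by (subst inner_commute, subst T_w, simp, rule inner_sum_left) (auto intro!: T_l2 i)
    finally have S: "S = T (1/2) w (v 0) * m (v 0)" by simp
    have "T (1/2) w \<in> dirichlet_domain X b m" using u by (auto simp: dirichlet_laplacian_def)
    from path_end_le_energy[OF v s this]
    have "(T (1/2) w (v 0))\<^sup>2 \<le> 8 * ?R * (p 0 + S)"
      using mult_left_mono[OF e, of "8 * ?R"] R by linarith
    from mult_right_mono[OF this, of "(m (v 0))\<^sup>2"]
    have SK: "S * S \<le> K * (p 0 + S)"
      by (simp add: S K_def power2_eq_square algebra_simps)
    \<comment> \<open>Otherwise \<open>S * S\<close> exceeds \<open>K * S + p 0 * S\<close>, which
      is at least \<open>K * S + K * p 0\<close>, contradicting \<open>SK\<close>.\<close>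
    have "S \<le> K + p 0"
    proof (rule ccontr)
      assume "\<not> S \<le> K + p 0"
      then have "S > K + p 0" by simp
      moreover then have "S > 0" using K p0[of 0] by simp
      ultimately have "(K + p 0) * S < S * S" by (rule mult_strict_right_mono)
      moreover have "K * p 0 \<le> p 0 * S" using \<open>S > K + p 0\<close> p0[of 0]
        by (subst mult.commute, intro mult_left_mono) auto
      ultimately show False using SK by (simp add: algebra_simps)
    qed
    then show ?thesis using \<open>(\<Sum>k<N. p (real k)) \<le> p 0 + S\<close> by simp
  qed
  have "summable (\<lambda>k. p (real k))"
    by (rule summableI_nonneg_bounded[OF _ bound]) (simp add: p0)
  then show ?thesis by (simp add: p_def)
qed

text \<open>The diagonal heat kernel decreases in time, so on [k, k + 1) it is at most its value at
  k, and the integral is dominated by the series.\<close>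

lemma heat_kernel_integral_finite:
  assumes x: "x \<in> X"
    and s: "summable (\<lambda>k. ip (T (real k) (indicator {x})) (indicator {x}))"
  shows "(\<integral>\<^sup>+t\<in>{0..}. ennreal (T t (indicator {x}) x) \<partial>lborel) < \<infinity>"
proof -
  let ?i = "indicator {x} :: 'a \<Rightarrow> real"
  define a where "a k = ip (T (real k) ?i) ?i / m x" for k
  have i: "?i \<in> L2" by (rule indicator_l2[OF x])
  have a0: "a k \<ge> 0" for k using inner_T_nonneg[OF i, of "real k"] m_pos[OF x] by (simp add: a_def)
  have a: "summable a" unfolding a_def by (intro summable_divide s)
  have "(\<integral>\<^sup>+t\<in>{0..}. ennreal (T t ?i x) \<partial>lborel)
      \<le> (\<integral>\<^sup>+t. (\<Sum>k. ennreal (a k) * indicator {real k..<real k + 1} t) \<partial>lborel)"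
  proof (rule nn_integral_mono)
    fix t :: real
    show "ennreal (T t ?i x) * indicator {0..} t \<le> (\<Sum>k. ennreal (a k) * indicator {real k..<real k + 1} t)"
    proof (cases "t \<ge> 0")
      case True
      define k where "k = nat \<lfloor>t\<rfloor>"
      have k: "real k \<le> t" "t < real k + 1" using True by (auto simp: k_def)
      have "T t ?i x = ip (T t ?i) ?i / m x"
        using m_pos[OF x] by (subst inner_commute) (simp add: inner_indicator[OF x])
      also have "\<dots> \<le> a k" unfolding a_def using inner_T_antimono[OF i _ k(1)] m_pos[OF x]
        by (intro divide_right_mono) auto
      finally have "ennreal (T t ?i x) * indicator {0..} t
          \<le> (\<Sum>k\<in>{k}. ennreal (a k) * indicator {real k..<real k + 1} t)"
        using k True by (simp add: ennreal_leI)
      also have "\<dots> \<le> (\<Sum>k. ennreal (a k) * indicator {real k..<real k + 1} t)"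
        by (rule sum_le_suminf) auto
      finally show ?thesis .
    qed simp
  qed
  also have "\<dots> = (\<Sum>k. \<integral>\<^sup>+t. ennreal (a k) * indicator {real k..<real k + 1} t \<partial>lborel)"
    by (rule nn_integral_suminf) auto
  also have "\<dots> = (\<Sum>k. ennreal (a k))"
    by (simp add: nn_integral_cmult_indicator)
  also have "\<dots> = ennreal (\<Sum>k. a k)" by (rule suminf_ennreal2[OF a0 a])
  finally show ?thesis by (simp add: le_less_trans)
qed

end

context weighted_graph
begin

text \<open>Transience quantifies over all heat semigroups, so its negation supplies one, together
  with infinite integrals at all pairs of vertices. The pair \<open>v 0\<close>, \<open>v 0\<close>
  gives the contradiction.\<close>

lemma recurrent_imp_divergent_resistance:
  assumes "recurrent_graph X b m"
    and v: "inj v" "\<And>k. v k \<in> X" "\<And>k. b (v k) (v (Suc k)) > 0"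
  shows "\<not> summable (\<lambda>k. 1 / b (v k) (v (Suc k)))"
proof
  assume s: "summable (\<lambda>k. 1 / b (v k) (v (Suc k)))"
  from assms(1) obtain T where T: "heat_semigroup X b m T"
    and inf: "\<And>x y. x \<in> X \<Longrightarrow> y \<in> X \<Longrightarrow>
      \<not> (\<integral>\<^sup>+t\<in>{0..}. ennreal (T t (indicator {y}) x) \<partial>lborel) < \<infinity>"
    unfolding recurrent_graph_def transient_graph_def by blast
  interpret heat_flow X m b T by unfold_locales (rule T)
  show False
    using inf[OF v(2)[of 0] v(2)[of 0]] heat_kernel_integral_finite[OF v(2) summable_heat_kernel[OF v s]]
    by blast
qed

end

section \<open>Essential self-adjointness on a ray\<close>

locale ray = weighted_graph X m b
  for X :: "'a set" and m :: "'a \<Rightarrow> real" and b :: "'a \<Rightarrow> 'a \<Rightarrow> real" +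
  fixes v :: "nat \<Rightarrow> 'a"
  assumes inj_v: "inj v" and X_eq: "X = range v"
    and b_pos_iff: "b (v i) (v j) > 0 \<longleftrightarrow> i = Suc j \<or> j = Suc i"
begin

abbreviation "\<Delta> \<equiv> laplacian X b m"
abbreviation "minop \<equiv> minimal_laplacian X b m"

definition c :: "nat \<Rightarrow> real" where "c k = b (v k) (v (Suc k))"

definition flux :: "('a \<Rightarrow> real) \<Rightarrow> nat \<Rightarrow> real" where
  "flux f k = c k * (f (v (Suc k)) - f (v k))"

text \<open>This is \<open>f (v k) * flux g k - g (v k) * flux f k\<close>, the boundary term in
  Green's formula cut off after \<open>v k\<close>.\<close>

definition wronskian :: "('a \<Rightarrow> real) \<Rightarrow> ('a \<Rightarrow> real) \<Rightarrow> nat \<Rightarrow> real" where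
  "wronskian f g k = c k * (f (v k) * g (v (Suc k)) - f (v (Suc k)) * g (v k))"

text \<open>The Laplacian on its largest domain in \<open>L2\<close>; it turns out to be the adjoint
  of \<open>minop\<close>.\<close>

definition maxop :: "'a oper" where
  "maxop = {(g, \<Delta> g) | g. g \<in> L2 \<and> \<Delta> g \<in> L2}"

definition resistance :: "nat \<Rightarrow> real" where
  "resistance k = (\<Sum>i<k. 1 / c i)"

definition resistance_function :: "'a \<Rightarrow> real" where
  "resistance_function x = (if x \<in> X then resistance (inv v x) else 0)"

lemma v_in_X [simp]: "v k \<in> X"
  by (simp add: X_eq)

lemma v_eq_iff [simp]: "v i = v j \<longleftrightarrow> i = j"
  using inj_v by (auto dest: injD)

lemma m_v_pos [simp]: "m (v k) > 0"
  by (rule m_pos) simp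

lemma m_v_nonzero [simp]: "m (v k) \<noteq> 0"
  using m_v_pos[of k] by linarith

lemma c_pos [simp]: "c k > 0"
  by (simp add: c_def b_pos_iff)

lemma c_nonzero [simp]: "c k \<noteq> 0"
  using c_pos[of k] by linarith

lemma ext_X:
  assumes "\<And>k. f (v k) = g (v k)" "\<And>x. x \<notin> X \<Longrightarrow> f x = g x"
  shows "f = g"
  using assms by (metis X_eq ext rangeE)

lemma laplacian_outside: "x \<notin> X \<Longrightarrow> \<Delta> f x = 0"
  by (simp add: laplacian_def)

section \<open>Laplacian, flux and Wronskian on a ray\<close>

text \<open>In the induced subgraph \<open>v 0\<close> has the single neighbour \<open>v 1\<close>;
  an edge leading out of \<open>X\<close> does not enter, so there is no incoming flux.\<close>

lemma laplacian_v_0: "\<Delta> f (v 0) * m (v 0) = - flux f 0"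
proof -
  have "{y \<in> X. b (v 0) y \<noteq> 0} = {v 1}"
    using b_pos_iff[of 0] b_nonneg[of "v 0"] by (auto simp: X_eq less_le)
  then show ?thesis
    by (subst laplacian_finite_sum) (simp_all add: flux_def c_def algebra_simps)
qed

lemma laplacian_v_Suc: "\<Delta> f (v (Suc k)) * m (v (Suc k)) = flux f k - flux f (Suc k)"
proof -
  have "{y \<in> X. b (v (Suc k)) y \<noteq> 0} = {v k, v (Suc (Suc k))}"
    using b_pos_iff[of "Suc k"] b_nonneg[of "v (Suc k)"] by (auto simp: X_eq less_le)
  then show ?thesis
    by (subst laplacian_finite_sum)
      (simp_all add: flux_def c_def b_sym[of "v (Suc k)" "v k"] algebra_simps)
qed

lemma laplacian_v_eqI:
  assumes "\<Delta> f (v k) * m (v k) = y * m (v k)"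
  shows "\<Delta> f (v k) = y"
  using assms by simp

lemma flux_lincomb: "flux (\<lambda>x. r * f x + s * g x) k = r * flux f k + s * flux g k"
  by (simp add: flux_def algebra_simps)

lemma laplacian_lincomb: "\<Delta> (\<lambda>x. r * f x + s * g x) = (\<lambda>x. r * \<Delta> f x + s * \<Delta> g x)"
proof (rule ext_X)
  fix k
  show "\<Delta> (\<lambda>x. r * f x + s * g x) (v k) = r * \<Delta> f (v k) + s * \<Delta> g (v k)"
    by (cases k; rule laplacian_v_eqI)
      (simp_all add: distrib_right mult.assoc laplacian_v_0 laplacian_v_Suc flux_lincomb right_diff_distrib)
qed (simp add: laplacian_outside)

lemma wronskian_lincomb: "wronskian (\<lambda>x. r * f x + s * g x) h k = r * wronskian f h k + s * wronskian g h k"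
  by (simp add: wronskian_def algebra_simps)

lemma wronskian_flip: "wronskian g f k = - wronskian f g k"
  by (simp add: wronskian_def algebra_simps)

lemma wronskian_Suc:
  "wronskian f g (Suc k) = wronskian f g k + (g (v (Suc k)) * \<Delta> f (v (Suc k)) - f (v (Suc k)) * \<Delta> g (v (Suc k))) * m (v (Suc k))"
proof -
  have "(g (v (Suc k)) * \<Delta> f (v (Suc k)) - f (v (Suc k)) * \<Delta> g (v (Suc k))) * m (v (Suc k))
      = g (v (Suc k)) * (\<Delta> f (v (Suc k)) * m (v (Suc k))) - f (v (Suc k)) * (\<Delta> g (v (Suc k)) * m (v (Suc k)))"
    by (simp add: algebra_simps)
  then show ?thesis
    unfolding laplacian_v_Suc by (simp add: wronskian_def flux_def algebra_simps)
qed

lemma wronskian_eq_sum: "wronskian f g N = (\<Sum>k\<le>N. (g (v k) * \<Delta> f (v k) - f (v k) * \<Delta> g (v k)) * m (v k))"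
proof (induction N)
  case 0
  have "(g (v 0) * \<Delta> f (v 0) - f (v 0) * \<Delta> g (v 0)) * m (v 0)
      = g (v 0) * (\<Delta> f (v 0) * m (v 0)) - f (v 0) * (\<Delta> g (v 0) * m (v 0))"
    by (simp add: algebra_simps)
  then show ?case unfolding laplacian_v_0 by (simp add: wronskian_def flux_def algebra_simps)
qed (simp add: wronskian_Suc)

text \<open>The Wronskian is, up to \<open>c k\<close>, a 2x2 determinant of values at
  \<open>v k\<close> and \<open>v (Suc k)\<close>, and this is the Pluecker relation for four
  vectors in the plane. It expresses the Wronskian of \<open>g\<close> and \<open>h\<close> by those
  with two reference functions.\<close>

lemma wronskian_pluecker: "wronskian g h k * wronskian e f k = wronskian g e k * wronskian h f k - wronskian g f k * wronskian h e k"
  by (simp add: wronskian_def algebra_simps)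

lemma summable_on_ray_iff:
  "(\<lambda>x. (f x)\<^sup>2 * m x) summable_on X \<longleftrightarrow> summable (\<lambda>k. (f (v k))\<^sup>2 * m (v k))"
proof -
  have "(\<lambda>x. (f x)\<^sup>2 * m x) summable_on X \<longleftrightarrow> (\<lambda>k. (f (v k))\<^sup>2 * m (v k)) summable_on UNIV"
    using inj_v by (simp add: X_eq summable_on_reindex o_def)
  also have "\<dots> \<longleftrightarrow> summable (\<lambda>k. (f (v k))\<^sup>2 * m (v k))"
    by (rule summable_on_UNIV_nonneg_real_iff) (simp add: less_imp_le)
  finally show ?thesis .
qed

lemma l2_ray_iff: "f \<in> L2 \<longleftrightarrow> (\<forall>x. x \<notin> X \<longrightarrow> f x = 0) \<and> summable (\<lambda>k. (f (v k))\<^sup>2 * m (v k))"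
  by (simp add: l2_def summable_on_ray_iff)

lemma inner_sums:
  assumes "f \<in> L2" "g \<in> L2"
  shows "(\<lambda>k. f (v k) * g (v k) * m (v k)) sums ip f g"
proof -
  have "((\<lambda>x. f x * g x * m x) has_sum ip f g) (range v)"
    using has_sum_infsum[OF l2_mult_summable[OF assms]] by (simp add: l2_inner_def X_eq)
  then have "((\<lambda>k. f (v k) * g (v k) * m (v k)) has_sum ip f g) UNIV"
    using inj_v by (simp add: has_sum_reindex o_def)
  then show ?thesis by (rule has_sum_imp_sums)
qed

text \<open>The Wronskian at N is a partial sum of the two inner product series. Its limit is the
  boundary form at infinity that measures the failure of symmetry of \<open>maxop\<close>.\<close>

lemma wronskian_tendsto:
  assumes "(g, g') \<in> maxop" "(h, h') \<in> maxop"
  shows "wronskian g h \<longlonglongrightarrow> ip g' h - ip g h'"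
proof -
  have l: "g \<in> L2" "g' \<in> L2" "h \<in> L2" "h' \<in> L2" and eq: "g' = \<Delta> g" "h' = \<Delta> h"
    using assms by (auto simp: maxop_def)
  have "(\<lambda>k. g' (v k) * h (v k) * m (v k) - g (v k) * h' (v k) * m (v k)) sums (ip g' h - ip g h')"
    by (intro sums_diff inner_sums l)
  then have "(\<lambda>N. \<Sum>k\<le>N. g' (v k) * h (v k) * m (v k) - g (v k) * h' (v k) * m (v k)) \<longlonglongrightarrow> ip g' h - ip g h'"
    by (simp add: sums_def_le)
  also have "(\<lambda>N. \<Sum>k\<le>N. g' (v k) * h (v k) * m (v k) - g (v k) * h' (v k) * m (v k)) = wronskian g h"
    unfolding eq by (auto simp: wronskian_eq_sum algebra_simps intro!: sum.cong)
  finally show ?thesis .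
qed

section \<open>Green's formula and the adjoint of the minimal Laplacian\<close>

lemma finitely_supported_bound:
  assumes "f \<in> finitely_supported X"
  obtains K where "\<And>k. k \<ge> K \<Longrightarrow> f (v k) = 0"
proof -
  have "finite {k. f (v k) \<noteq> 0}"
    using finite_vimageI[OF _ inj_v, of "{x. f x \<noteq> 0}"] assms
    by (simp add: finitely_supported_def vimage_def)
  then obtain K where "\<And>k. k \<in> {k. f (v k) \<noteq> 0} \<Longrightarrow> k < K"
    by (metis finite_nat_bounded lessThan_iff subsetD)
  then have "f (v k) = 0" if "k \<ge> K" for k using that by fastforce
  then show thesis by (rule that)
qed

lemma finite_support_ray:
  assumes "\<And>k. k > N \<Longrightarrow> f (v k) = 0" "\<And>x. x \<notin> X \<Longrightarrow> f x = 0"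
  shows "x \<notin> v ` {..N} \<Longrightarrow> f x = 0"
  using assms by (metis X_eq atMost_iff imageI not_le rangeE)

text \<open>The Laplacian enlarges the support by at most one vertex: \<open>v K\<close> may be
  reached from its predecessor, whereas beyond it both adjacent fluxes vanish.\<close>

lemma laplacian_finitely_supported:
  assumes f: "\<And>k. k \<ge> K \<Longrightarrow> f (v k) = 0" and x: "x \<notin> v ` {..K}"
  shows "\<Delta> f x = 0"
proof (rule finite_support_ray[where f = "\<Delta> f", OF _ laplacian_outside x])
  fix k assume "k > K"
  then obtain j where "k = Suc j" "j \<ge> K" by (cases k) auto
  then show "\<Delta> f (v k) = 0"
    using f by (intro laplacian_v_eqI) (simp add: laplacian_v_Suc flux_def)
qed

lemma minop_subset_maxop: "minop \<subseteq> maxop"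
proof
  fix p assume "p \<in> minop"
  then obtain f where p: "p = (f, \<Delta> f)" and f: "f \<in> finitely_supported X"
    by (auto simp: minimal_laplacian_def)
  obtain K where K: "\<And>k. k \<ge> K \<Longrightarrow> f (v k) = 0" using finitely_supported_bound[OF f] by blast
  have "\<Delta> f \<in> L2"
    by (rule l2_finite_support[of "v ` {..K}"])
      (use laplacian_finitely_supported[where f = f, OF K] in auto)
  then show "p \<in> maxop" using finitely_supported_l2[OF f] by (auto simp: maxop_def p)
qed

lemma green_finitely_supported:
  assumes f: "f \<in> finitely_supported X"
  shows "ip (\<Delta> f) g = ip f (\<Delta> g)"
proof -
  obtain K where K: "\<And>k. k \<ge> K \<Longrightarrow> f (v k) = 0" using finitely_supported_bound[OF f] by blast
  have out: "x \<notin> X \<Longrightarrow> f x = 0" for x using f by (auto simp: finitely_supported_def)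
  have "ip (\<Delta> f) g = (\<Sum>x\<in>v ` {..K}. \<Delta> f x * g x * m x)"
    by (rule inner_finite_support)
      (use laplacian_finitely_supported[where f = f, OF K] in auto)
  moreover have "ip f (\<Delta> g) = (\<Sum>x\<in>v ` {..K}. f x * \<Delta> g x * m x)"
    by (rule inner_finite_support) (use finite_support_ray[of K f] K out in auto)
  ultimately have "ip (\<Delta> f) g - ip f (\<Delta> g) = wronskian f g K"
    by (simp add: wronskian_eq_sum sum.reindex inj_on_def sum_subtractf[symmetric] algebra_simps)
  also have "\<dots> = 0" using K by (simp add: wronskian_def)
  finally show ?thesis by simp
qed

text \<open>Testing the adjoint relation with point masses determines the image pointwise as the
  formal Laplacian; the converse is Green's formula, whose second argument may be any
  function.\<close>

lemma adjoint_minop: "adjoint_operator X m minop = maxop"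
proof (intro equalityI subsetI)
  fix p assume "p \<in> adjoint_operator X m minop"
  then obtain g h where p: "p = (g, h)" and l: "g \<in> L2" "h \<in> L2"
    and eq: "\<And>f. f \<in> finitely_supported X \<Longrightarrow> ip (\<Delta> f) g = ip f h"
    by (auto simp: adjoint_operator_def minimal_laplacian_def)
  have "h = \<Delta> g"
  proof (rule ext_X)
    fix k
    have fs: "(indicator {v k} :: 'a \<Rightarrow> real) \<in> finitely_supported X"
      by (auto simp: finitely_supported_def indicator_def)
    have "ip (indicator {v k}) h = ip (indicator {v k}) (\<Delta> g)"
      using eq[OF fs] green_finitely_supported[OF fs] by simp
    then show "h (v k) = \<Delta> g (v k)" by (simp add: inner_indicator)
  qed (use l in \<open>simp add: laplacian_outside l2_def\<close>)
  then show "p \<in> maxop" using l by (auto simp: maxop_def p)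
next
  fix p assume "p \<in> maxop"
  then show "p \<in> adjoint_operator X m minop"
    by (auto simp: maxop_def adjoint_operator_def minimal_laplacian_def green_finitely_supported)
qed

lemma finitely_supported_dense:
  assumes f: "f \<in> L2" and "\<epsilon> > 0"
  shows "\<exists>g\<in>finitely_supported X. nrm (\<lambda>x. f x - g x) < \<epsilon>"
proof -
  let ?s = "\<lambda>k. (f (v k))\<^sup>2 * m (v k)"
  have s: "summable ?s" and out: "\<And>x. x \<notin> X \<Longrightarrow> f x = 0" using f by (auto simp: l2_ray_iff)
  obtain N where N: "norm (\<Sum>k. ?s (k + N)) < \<epsilon>\<^sup>2"
    using suminf_exist_split[OF _ s, of "\<epsilon>\<^sup>2"] \<open>\<epsilon> > 0\<close> by auto
  define g where "g x = (if x \<in> v ` {..<N} then f x else 0)" for x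
  have "{x. g x \<noteq> 0} \<subseteq> v ` {..<N}" by (auto simp: g_def)
  then have g: "g \<in> finitely_supported X"
    by (auto simp: finitely_supported_def X_eq intro: finite_subset)
  let ?d = "\<lambda>x. f x - g x"
  have d: "?d \<in> L2" by (intro l2_diff f finitely_supported_l2 g)
  have dv: "?d (v k) * ?d (v k) * m (v k) = (if k < N then 0 else ?s k)" for k
    by (auto simp: g_def power2_eq_square)
  have "ip ?d ?d = (\<Sum>k. ?d (v k) * ?d (v k) * m (v k))"
    using inner_sums[OF d d] by (simp add: sums_iff)
  also have "\<dots> = (\<Sum>k. ?d (v (k + N)) * ?d (v (k + N)) * m (v (k + N)))
      + (\<Sum>k<N. ?d (v k) * ?d (v k) * m (v k))"
    using inner_sums[OF d d] by (intro suminf_split_initial_segment) (simp add: sums_iff)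
  also have "\<dots> = (\<Sum>k. ?s (k + N))" unfolding dv by simp
  finally have "(nrm ?d)\<^sup>2 < \<epsilon>\<^sup>2" using N by (simp add: norm_square)
  then show ?thesis using g \<open>\<epsilon> > 0\<close> by (auto intro!: bexI[of _ g] power2_less_imp_less)
qed

section \<open>Self-adjoint extensions and boundary conditions at infinity\<close>

text \<open>An extension of \<open>minop\<close> has its adjoint inside \<open>maxop\<close>, so
  maximality need only be tested there. Density of the domain is inherited from the finitely
  supported functions.\<close>

lemma self_adjointI:
  assumes "minop \<subseteq> B" "B \<subseteq> maxop"
    and lin: "\<And>f f' g g' r s. (f, f') \<in> B \<Longrightarrow> (g, g') \<in> B \<Longrightarrow>
      (\<lambda>x. r * f x + s * g x, \<lambda>x. r * f' x + s * g' x) \<in> B"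
    and sym: "\<And>f f' g g'. (f, f') \<in> B \<Longrightarrow> (g, g') \<in> B \<Longrightarrow> ip f' g = ip f g'"
    and max: "\<And>g g'. (g, g') \<in> maxop \<Longrightarrow> (\<And>f f'. (f, f') \<in> B \<Longrightarrow> ip f' g = ip f g') \<Longrightarrow> (g, g') \<in> B"
  shows "self_adjoint X m B"
proof -
  have sub: "B \<subseteq> L2 \<times> L2" using assms(2) by (auto simp: maxop_def)
  have "finitely_supported X \<subseteq> Domain B"
    using assms(1) by (auto simp: minimal_laplacian_def)
  then have dense: "\<forall>f\<in>L2. \<forall>\<epsilon>>0. \<exists>g\<in>Domain B. nrm (\<lambda>x. f x - g x) < \<epsilon>"
    using finitely_supported_dense by blast
  have "single_valued B" using assms(2) by (auto simp: maxop_def single_valued_def)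
  then have "densely_defined_operator X m B"
    using sub lin dense by (simp add: densely_defined_operator_def)
  moreover have "adjoint_operator X m B \<subseteq> adjoint_operator X m minop"
    using assms(1) by (auto simp: adjoint_operator_def)
  then have "adjoint_operator X m B = B"
    using sub sym max unfolding adjoint_minop by (fastforce simp: adjoint_operator_def)
  ultimately show ?thesis by (simp add: self_adjoint_def)
qed

lemma maxop_lincomb:
  "(f, f') \<in> maxop \<Longrightarrow> (g, g') \<in> maxop \<Longrightarrow> (\<lambda>x. r * f x + s * g x, \<lambda>x. r * f' x + s * g' x) \<in> maxop"
  by (auto simp: maxop_def laplacian_lincomb l2_lincomb)

text \<open>Here \<open>maxop\<close> is symmetric, hence self-adjoint. A self-adjoint extension B
  of \<open>minop\<close> lies in \<open>maxop\<close> by taking adjoints, and symmetry of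
  \<open>maxop\<close> then places \<open>maxop\<close> in the adjoint of B, which is B.\<close>

lemma essentially_self_adjoint_if_wronskian_tendsto_0:
  assumes W0: "\<And>g g' h h'. (g, g') \<in> maxop \<Longrightarrow> (h, h') \<in> maxop \<Longrightarrow> wronskian g h \<longlonglongrightarrow> 0"
  shows "essentially_self_adjoint X m minop"
proof -
  have sym: "ip f' g = ip f g'" if "(f, f') \<in> maxop" "(g, g') \<in> maxop" for f f' g g'
    using LIMSEQ_unique[OF wronskian_tendsto[OF that] W0[OF that]] by simp
  have "self_adjoint X m maxop"
    by (rule self_adjointI) (auto simp: minop_subset_maxop maxop_lincomb intro: sym)
  moreover have "B = maxop" if "minop \<subseteq> B" "self_adjoint X m B" for B
  proof
    have adj: "adjoint_operator X m B = B" using that by (simp add: self_adjoint_def)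
    show BM: "B \<subseteq> maxop"
      using that(1) unfolding adjoint_minop[symmetric] by (subst adj[symmetric]) (auto simp: adjoint_operator_def)
    show "maxop \<subseteq> B"
    proof
      fix p assume p: "p \<in> maxop"
      then have "p \<in> adjoint_operator X m B"
        using BM sym by (auto simp: adjoint_operator_def maxop_def)
      then show "p \<in> B" by (simp add: adj)
    qed
  qed
  ultimately show ?thesis
    unfolding essentially_self_adjoint_def using minop_subset_maxop by blast
qed

lemma resistance_function_v [simp]: "resistance_function (v k) = resistance k"
  by (simp add: resistance_function_def inv_f_f inj_v)

lemma resistance_function_outside: "x \<notin> X \<Longrightarrow> resistance_function x = 0"
  by (simp add: resistance_function_def)

lemma flux_resistance_function: "flux resistance_function k = 1"
  by (simp add: flux_def resistance_def)

lemma laplacian_resistance_function_Suc: "\<Delta> resistance_function (v (Suc k)) = 0"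
  by (rule laplacian_v_eqI) (simp only: laplacian_v_Suc, simp add: flux_resistance_function)

text \<open>A boundary condition at infinity: the boundary form against \<open>u\<close>
  vanishes.\<close>

definition wronskian_extension :: "('a \<Rightarrow> real) \<Rightarrow> 'a oper" where
  "wronskian_extension u = {(g, g'). (g, g') \<in> maxop \<and> wronskian g u \<longlonglongrightarrow> 0}"

lemma minop_subset_wronskian_extension: "minop \<subseteq> wronskian_extension u"
proof
  fix p assume p: "p \<in> minop"
  then obtain f where f: "p = (f, \<Delta> f)" "f \<in> finitely_supported X" by (auto simp: minimal_laplacian_def)
  obtain K where K: "\<And>k. k \<ge> K \<Longrightarrow> f (v k) = 0" using finitely_supported_bound[OF f(2)] by blast
  then have "\<forall>k\<ge>K. wronskian f u k = 0" by (simp add: wronskian_def)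
  then have "wronskian f u \<longlonglongrightarrow> 0"
    by (intro tendsto_eventually) (auto simp: eventually_sequentially)
  then show "p \<in> wronskian_extension u" using p minop_subset_maxop f by (auto simp: wronskian_extension_def)
qed

lemma self_adjoint_wronskian_extension:
  assumes u: "(u, u') \<in> maxop" and w: "(w, w') \<in> maxop"
    and wronskian: "\<And>k. wronskian u w k = s" and s: "s \<noteq> 0"
  shows "self_adjoint X m (wronskian_extension u)"
proof (rule self_adjointI)
  show "minop \<subseteq> wronskian_extension u" by (rule minop_subset_wronskian_extension)
  show "wronskian_extension u \<subseteq> maxop" by (auto simp: wronskian_extension_def)
next
  fix f f' g g' r s assume "(f, f') \<in> wronskian_extension u" "(g, g') \<in> wronskian_extension u"
  then have m: "(f, f') \<in> maxop" "(g, g') \<in> maxop" and z: "wronskian f u \<longlonglongrightarrow> 0" "wronskian g u \<longlonglongrightarrow> 0"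
    by (auto simp: wronskian_extension_def)
  have "(\<lambda>k. r * wronskian f u k + s * wronskian g u k) \<longlonglongrightarrow> r * 0 + s * 0"
    by (intro tendsto_intros z)
  then have "wronskian (\<lambda>x. r * f x + s * g x) u \<longlonglongrightarrow> 0" by (simp add: wronskian_lincomb[abs_def])
  then show "(\<lambda>x. r * f x + s * g x, \<lambda>x. r * f' x + s * g' x) \<in> wronskian_extension u"
    using maxop_lincomb[OF m] by (simp add: wronskian_extension_def)
next
  fix f f' g g' assume "(f, f') \<in> wronskian_extension u" "(g, g') \<in> wronskian_extension u"
  then have m: "(f, f') \<in> maxop" "(g, g') \<in> maxop" and z: "wronskian f u \<longlonglongrightarrow> 0" "wronskian g u \<longlonglongrightarrow> 0"
    by (auto simp: wronskian_extension_def)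
  \<comment> \<open>In the Pluecker relation each product has one factor tending to 0 and one that
    converges, so the Wronskian of \<open>f\<close> and \<open>g\<close> tends to 0.\<close>
  have "(\<lambda>k. wronskian f u k * wronskian g w k - wronskian f w k * wronskian g u k)
      \<longlonglongrightarrow> 0 * (ip g' w - ip g w') - (ip f' w - ip f w') * 0"
    by (intro tendsto_diff tendsto_mult z wronskian_tendsto m w)
  then have "(\<lambda>k. wronskian f g k * s) \<longlonglongrightarrow> 0"
    unfolding wronskian_pluecker[of f g _ u w, symmetric] wronskian by simp
  moreover have "(\<lambda>k. wronskian f g k * s) \<longlonglongrightarrow> (ip f' g - ip f g') * s"
    by (intro tendsto_mult tendsto_const wronskian_tendsto m)
  ultimately have "(ip f' g - ip f g') * s = 0" by (rule LIMSEQ_unique[rotated])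
  then show "ip f' g = ip f g'" using s by simp
next
  fix g g' assume g: "(g, g') \<in> maxop" and eq: "\<And>f f'. (f, f') \<in> wronskian_extension u \<Longrightarrow> ip f' g = ip f g'"
  \<comment> \<open>\<open>u\<close> satisfies its own boundary condition, so it may serve as the
    test function that forces this condition on \<open>g\<close>.\<close>
  have "wronskian u u = (\<lambda>k. 0)" by (auto simp: wronskian_def)
  then have "(u, u') \<in> wronskian_extension u" using u by (simp add: wronskian_extension_def)
  then have "wronskian u g \<longlonglongrightarrow> 0" using wronskian_tendsto[OF u g] eq[of u u'] by simp
  then have "wronskian g u \<longlonglongrightarrow> 0"
    using tendsto_minus[of "wronskian u g" 0] by (simp add: wronskian_flip[of g u, abs_def])
  then show "(g, g') \<in> wronskian_extension u" using g by (simp add: wronskian_extension_def)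
qed

section \<open>Square summability of affine functions of the resistance\<close>

text \<open>From index 1 on the resistance is at least \<open>1 / c 0\<close>, so the given series
  dominates a multiple of the measure; index 0, where the resistance is 0, is skipped.\<close>

lemma summable_measure:
  assumes s: "summable (\<lambda>k. (resistance k)\<^sup>2 * m (v k))"
  shows "summable (\<lambda>k. m (v k))"
proof -
  have res: "1 \<le> (c 0)\<^sup>2 * (resistance k)\<^sup>2" if "k \<ge> 1" for k
  proof -
    have "(\<Sum>i<1. 1 / c i) \<le> resistance k"
      unfolding resistance_def using that by (intro sum_mono2) (auto simp: less_imp_le)
    then have "1 \<le> c 0 * resistance k" by (simp add: field_simps)
    from power_mono[OF this, of 2] show ?thesis by (simp add: power_mult_distrib)
  qed
  have "summable (\<lambda>k. (c 0)\<^sup>2 * ((resistance k)\<^sup>2 * m (v k)))" by (rule summable_mult[OF s])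
  then show ?thesis
  proof (rule summable_comparison_test_ev[rotated])
    have "norm (m (v k)) \<le> (c 0)\<^sup>2 * ((resistance k)\<^sup>2 * m (v k))" if "k \<ge> 1" for k
      using mult_right_mono[OF res[OF that], of "m (v k)"] less_imp_le[OF m_v_pos[of k]] by (simp add: mult.assoc)
    then show "\<forall>\<^sub>F k in sequentially. norm (m (v k)) \<le> (c 0)\<^sup>2 * ((resistance k)\<^sup>2 * m (v k))"
      by (auto simp: eventually_sequentially)
  qed
qed

lemma summable_affine_resistance:
  assumes s: "summable (\<lambda>k. (resistance k)\<^sup>2 * m (v k))"
  shows "summable (\<lambda>k. (\<alpha> + \<beta> * resistance k)\<^sup>2 * m (v k))"
proof (rule summable_comparison_test')
  show "summable (\<lambda>k. 2 * \<alpha>\<^sup>2 * m (v k) + 2 * \<beta>\<^sup>2 * ((resistance k)\<^sup>2 * m (v k)))"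
    by (intro summable_add summable_mult s summable_measure)
  fix k :: nat
  have "(\<alpha> + \<beta> * resistance k)\<^sup>2 \<le> 2 * \<alpha>\<^sup>2 + 2 * \<beta>\<^sup>2 * (resistance k)\<^sup>2"
    using zero_le_power2[of "\<alpha> - \<beta> * resistance k"] by (simp add: power2_eq_square algebra_simps)
  from mult_right_mono[OF this, of "m (v k)"]
  show "norm ((\<alpha> + \<beta> * resistance k)\<^sup>2 * m (v k))
      \<le> 2 * \<alpha>\<^sup>2 * m (v k) + 2 * \<beta>\<^sup>2 * ((resistance k)\<^sup>2 * m (v k))"
    by (simp add: less_imp_le algebra_simps)
qed

lemma resistance_mono: "j \<le> k \<Longrightarrow> resistance j \<le> resistance k"
  unfolding resistance_def by (intro sum_mono2) (auto simp: less_imp_le)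

text \<open>Divergence lets \<open>\<beta> * resistance k\<close> eventually outweigh
  \<open>2 * \<bar>\<alpha>\<bar>\<close>, so the constant can no longer cancel more than half of
  it. A bounded resistance might approach \<open>- \<alpha> / \<beta>\<close>.\<close>

lemma summable_resistance:
  assumes div: "\<not> summable (\<lambda>k. 1 / c k)" and "\<beta> \<noteq> 0"
    and s: "summable (\<lambda>k. (\<alpha> + \<beta> * resistance k)\<^sup>2 * m (v k))"
  shows "summable (\<lambda>k. (resistance k)\<^sup>2 * m (v k))"
proof -
  have "\<not> (\<forall>n. resistance n \<le> 2 * \<bar>\<alpha>\<bar> / \<bar>\<beta>\<bar>)"
  proof
    assume "\<forall>n. resistance n \<le> 2 * \<bar>\<alpha>\<bar> / \<bar>\<beta>\<bar>"
    then have "summable (\<lambda>k. 1 / c k)"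
      by (intro summableI_nonneg_bounded[of _ "2 * \<bar>\<alpha>\<bar> / \<bar>\<beta>\<bar>"])
        (auto simp: resistance_def less_imp_le)
    with div show False ..
  qed
  then obtain n where n: "2 * \<bar>\<alpha>\<bar> / \<bar>\<beta>\<bar> < resistance n" by (auto simp: not_le)
  have bound: "norm ((resistance k)\<^sup>2 * m (v k)) \<le> 4 / \<beta>\<^sup>2 * ((\<alpha> + \<beta> * resistance k)\<^sup>2 * m (v k))"
    if "k \<ge> n" for k
  proof -
    have "2 * \<bar>\<alpha>\<bar> / \<bar>\<beta>\<bar> \<le> resistance k" using n resistance_mono[OF that] by simp
    then have "2 * \<bar>\<alpha>\<bar> \<le> \<bar>\<beta>\<bar> * resistance k" using \<open>\<beta> \<noteq> 0\<close> by (simp add: field_simps)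
    moreover have "0 \<le> resistance k" by (simp add: resistance_def sum_nonneg less_imp_le)
    ultimately have "\<bar>\<beta> * resistance k\<bar> \<le> \<bar>2 * (\<alpha> + \<beta> * resistance k)\<bar>"
      by (simp add: abs_mult)
    then have "(\<beta> * resistance k)\<^sup>2 \<le> (2 * (\<alpha> + \<beta> * resistance k))\<^sup>2"
      by (simp only: abs_le_square_iff)
    then have "\<beta>\<^sup>2 * (resistance k)\<^sup>2 \<le> 4 * (\<alpha> + \<beta> * resistance k)\<^sup>2"
      unfolding power_mult_distrib[of 2] power_mult_distrib[of \<beta>] by simp
    then have "(resistance k)\<^sup>2 \<le> 4 / \<beta>\<^sup>2 * (\<alpha> + \<beta> * resistance k)\<^sup>2"
      using \<open>\<beta> \<noteq> 0\<close> by (simp add: pos_le_divide_eq mult.commute)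
    from mult_right_mono[OF this, of "m (v k)"] show ?thesis by (simp add: less_imp_le mult_ac)
  qed
  show ?thesis
    by (rule summable_comparison_test'[OF summable_mult[OF s, of "4 / \<beta>\<^sup>2"] bound])
qed

section \<open>Two extensions when the resistance is square summable\<close>

text \<open>The constant 1 and the resistance function both lie in the domain of
  \<open>maxop\<close> and have Wronskian 1. The constant meets the boundary condition given by
  itself but not the one given by the resistance, so the two extensions differ.\<close>

lemma not_essentially_self_adjoint_if_summable:
  assumes s: "summable (\<lambda>k. (resistance k)\<^sup>2 * m (v k))"
  shows "\<not> essentially_self_adjoint X m minop"
proof -
  \<comment> \<open>The constant 1 on the ray, extended by 0 as \<open>L2\<close> demands.\<close>
  let ?e = "indicator X :: 'a \<Rightarrow> real"
  have e: "?e \<in> L2" using summable_measure[OF s] by (simp add: l2_ray_iff)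
  have "\<Delta> ?e = (\<lambda>x. 0)"
  proof (rule ext_X)
    fix k show "\<Delta> ?e (v k) = 0"
      by (cases k; rule laplacian_v_eqI; simp only: laplacian_v_0 laplacian_v_Suc; simp add: flux_def)
  qed (simp add: laplacian_outside)
  then have eM: "(?e, \<lambda>x. 0) \<in> maxop" using e l2_zero by (auto simp: maxop_def)
  have "resistance_function \<in> L2" using s by (simp add: l2_ray_iff resistance_function_outside)
  moreover have "\<Delta> resistance_function \<in> L2"
  proof (rule l2_finite_support[of "v ` {..0}"])
    have "\<Delta> resistance_function (v k) = 0" if "k > 0" for k
      using that laplacian_resistance_function_Suc by (cases k) auto
    then show "\<Delta> resistance_function x = 0" if "x \<notin> v ` {..0}" for x
      by (rule finite_support_ray[where f = "\<Delta> resistance_function", OF _ laplacian_outside that])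
  qed auto
  ultimately have RM: "(resistance_function, \<Delta> resistance_function) \<in> maxop" by (auto simp: maxop_def)
  have eR: "wronskian ?e resistance_function k = 1" for k using flux_resistance_function[of k] by (simp add: wronskian_def flux_def)
  have Re: "wronskian resistance_function ?e k = - 1" for k by (subst wronskian_flip) (simp add: eR)
  have "self_adjoint X m (wronskian_extension ?e)" by (rule self_adjoint_wronskian_extension[OF eM RM eR]) simp
  moreover have "self_adjoint X m (wronskian_extension resistance_function)" by (rule self_adjoint_wronskian_extension[OF RM eM Re]) simp
  moreover have "(?e, \<lambda>x. 0) \<in> wronskian_extension ?e"
    using eM by (simp add: wronskian_extension_def wronskian_def[abs_def])
  moreover have "(?e, \<lambda>x. 0) \<notin> wronskian_extension resistance_function"
    by (simp add: wronskian_extension_def eR[abs_def] LIMSEQ_const_iff)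
  ultimately show ?thesis unfolding essentially_self_adjoint_def using minop_subset_wronskian_extension by metis
qed

section \<open>Weyl's limit point argument\<close>

lemma L2_set_le_norm:
  assumes "f \<in> L2" "finite A"
  shows "L2_set (\<lambda>k. \<bar>f (v k)\<bar> * sqrt (m (v k))) A \<le> nrm f"
proof -
  have "(\<Sum>k\<in>A. (f (v k))\<^sup>2 * m (v k)) \<le> (\<Sum>k. (f (v k))\<^sup>2 * m (v k))"
    using assms by (intro sum_le_suminf) (auto simp: l2_ray_iff less_imp_le)
  also have "\<dots> = ip f f"
    using inner_sums[OF assms(1,1)] by (simp add: sums_iff power2_eq_square)
  finally show ?thesis
    by (simp add: L2_set_def norm_eq_sqrt_inner power_mult_distrib less_imp_le)
qed

lemma L2_set_tail:
  assumes "f \<in> L2" "\<delta> > 0"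
  shows "\<exists>N. \<forall>M\<ge>N. \<forall>n. L2_set (\<lambda>k. \<bar>f (v k)\<bar> * sqrt (m (v k))) {M..<n} \<le> \<delta>"
proof -
  have "summable (\<lambda>k. (f (v k))\<^sup>2 * m (v k))" using assms by (simp add: l2_ray_iff)
  then obtain N where N: "\<And>M n. M \<ge> N \<Longrightarrow> norm (\<Sum>k=M..<n. (f (v k))\<^sup>2 * m (v k)) < \<delta>\<^sup>2"
    using \<open>\<delta> > 0\<close> unfolding summable_Cauchy by (metis zero_less_power)
  have "L2_set (\<lambda>k. \<bar>f (v k)\<bar> * sqrt (m (v k))) {M..<n} \<le> \<delta>" if "M \<ge> N" for M n
  proof -
    have "(\<Sum>k=M..<n. (f (v k))\<^sup>2 * m (v k)) \<le> \<delta>\<^sup>2" using N[OF that, of n] by simp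
    then show ?thesis using \<open>\<delta> > 0\<close>
      by (simp add: L2_set_def power_mult_distrib less_imp_le real_le_lsqrt real_sqrt_le_iff sum_nonneg)
  qed
  then show ?thesis by blast
qed

text \<open>As \<open>\<Delta> u\<close> vanishes past \<open>v 0\<close>, the Wronskian changes
  only by terms \<open>u * h' * m\<close>, estimated by Cauchy-Schwarz. Since \<open>u\<close> need
  not be in \<open>L2\<close>, only its norm over the window enters, and this bound is the same for
  all k in the window.\<close>

lemma wronskian_harmonic_bound:
  assumes u: "\<And>k. \<Delta> u (v (Suc k)) = 0" and h: "(h, h') \<in> maxop" and k: "k \<in> {M..<n}"
  shows "\<bar>wronskian u h k\<bar> \<le> \<bar>wronskian u h M\<bar> + L2_set (\<lambda>k. \<bar>u (v k)\<bar> * sqrt (m (v k))) {M..<n} * nrm h'"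
proof -
  have h': "h' = \<Delta> h" "h' \<in> L2" using h by (auto simp: maxop_def)
  have "M \<le> k" using k by simp
  then have "wronskian u h k = wronskian u h M - (\<Sum>j\<in>{M<..k}. u (v j) * h' (v j) * m (v j))"
  proof (induction k rule: dec_induct)
    case (step k)
    have "{M<..Suc k} = insert (Suc k) {M<..k}" using step by auto
    then show ?case using step u by (simp add: wronskian_Suc h')
  qed simp
  then have "\<bar>wronskian u h k\<bar> \<le> \<bar>wronskian u h M\<bar> + \<bar>\<Sum>j\<in>{M<..k}. u (v j) * h' (v j) * m (v j)\<bar>" by simp
  also have "\<bar>\<Sum>j\<in>{M<..k}. u (v j) * h' (v j) * m (v j)\<bar> \<le> (\<Sum>j\<in>{M<..k}. \<bar>u (v j) * h' (v j) * m (v j)\<bar>)"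
    by (rule sum_abs)
  also have "\<dots> \<le> (\<Sum>j\<in>{M..<n}. \<bar>u (v j) * h' (v j) * m (v j)\<bar>)"
    using k by (intro sum_mono2) auto
  also have "\<dots> = (\<Sum>j\<in>{M..<n}. \<bar>\<bar>u (v j)\<bar> * sqrt (m (v j))\<bar> * \<bar>\<bar>h' (v j)\<bar> * sqrt (m (v j))\<bar>)"
    by (intro sum.cong refl) (simp add: abs_mult less_imp_le mult_ac)
  also have "\<dots> \<le> L2_set (\<lambda>j. \<bar>u (v j)\<bar> * sqrt (m (v j))) {M..<n} * L2_set (\<lambda>j. \<bar>h' (v j)\<bar> * sqrt (m (v j))) {M..<n}"
    by (rule L2_set_mult_ineq)
  also have "\<dots> \<le> L2_set (\<lambda>j. \<bar>u (v j)\<bar> * sqrt (m (v j))) {M..<n} * nrm h'"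
    by (intro mult_left_mono L2_set_le_norm h' L2_set_nonneg) auto
  finally show ?thesis by simp
qed

text \<open>Weyl's argument: a nonzero limit of the Wronskian of \<open>g\<close> and \<open>h\<close> lets one express any solution
  \<open>u\<close> of \<open>\<Delta> u = 0\<close> through \<open>g\<close> and \<open>h\<close>, with coefficients that grow at most like the norm of \<open>u\<close>.\<close>

lemma summable_if_wronskian_nonzero:
  assumes g: "(g, g') \<in> maxop" and h: "(h, h') \<in> maxop" and w: "\<not> wronskian g h \<longlonglongrightarrow> 0"
    and u: "\<And>k. \<Delta> u (v (Suc k)) = 0"
  shows "summable (\<lambda>k. (u (v k))\<^sup>2 * m (v k))"
proof -
  define \<omega> where "\<omega> = ip g' h - ip g h'"
  have lim: "wronskian g h \<longlonglongrightarrow> \<omega>" unfolding \<omega>_def by (rule wronskian_tendsto[OF g h])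
  then have \<omega>: "\<bar>\<omega>\<bar> > 0" using w by auto
  define H where "H = nrm g' + nrm h'"
  have H: "H \<ge> 0" by (simp add: H_def norm_nonneg)
  \<comment> \<open>Small enough that the term containing the unknown norm of \<open>u\<close> can
    be absorbed later, which is \<open>\<delta>H\<close>.\<close>
  define \<delta> where "\<delta> = \<bar>\<omega>\<bar> / (8 * (H + 1))"
  have \<delta>: "\<delta> > 0" using \<omega> H by (simp add: \<delta>_def)
  have \<delta>H: "2 * \<delta> * H \<le> \<bar>\<omega>\<bar> / 4"
    using \<omega> H by (simp add: \<delta>_def field_simps)
  define t where "t f k = \<bar>f (v k)\<bar> * sqrt (m (v k))" for f k
  have t_nonneg: "t f k \<ge> 0" for f k by (simp add: t_def less_imp_le)
  have gl: "g \<in> L2" and hl: "h \<in> L2" using g h by (auto simp: maxop_def)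
  obtain N1 where N1: "\<And>M n. M \<ge> N1 \<Longrightarrow> L2_set (t g) {M..<n} \<le> \<delta>"
    using L2_set_tail[OF gl \<delta>] unfolding t_def by blast
  obtain N2 where N2: "\<And>M n. M \<ge> N2 \<Longrightarrow> L2_set (t h) {M..<n} \<le> \<delta>"
    using L2_set_tail[OF hl \<delta>] unfolding t_def by blast
  have "\<forall>\<^sub>F k in sequentially. \<bar>\<omega>\<bar> / 2 < \<bar>wronskian g h k\<bar>"
    using \<omega> by (intro order_tendstoD(1)[OF tendsto_rabs[OF lim]]) simp
  then obtain N3 where N3: "\<And>k. k \<ge> N3 \<Longrightarrow> \<bar>\<omega>\<bar> / 2 < \<bar>wronskian g h k\<bar>"
    by (auto simp: eventually_sequentially)
  \<comment> \<open>Beyond \<open>M\<close> the tails of \<open>g\<close> and \<open>h\<close> are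
    at most \<open>\<delta>\<close> and their Wronskian stays above half its limit in absolute
    value.\<close>
  define M where "M = max N1 (max N2 N3)"
  define A where "A = \<bar>wronskian u g M\<bar> + \<bar>wronskian u h M\<bar>"
  define B where "B = 2 * \<delta> * A / (\<bar>\<omega>\<bar> / 4)"
  have bound: "L2_set (t u) {M..<n} \<le> B" for n
  proof -
    let ?U = "L2_set (t u) {M..<n}"
    define C where "C = A + ?U * H"
    have U: "?U \<ge> 0" by (rule L2_set_nonneg)
    have C: "C \<ge> 0" using U H by (simp add: C_def A_def)
    have "t u k * (\<bar>\<omega>\<bar> / 2) \<le> C * t g k + C * t h k" if k: "k \<in> {M..<n}" for k
    proof -
      have W1: "\<bar>wronskian u g k\<bar> \<le> C"
      proof -
        have "\<bar>wronskian u g k\<bar> \<le> \<bar>wronskian u g M\<bar> + ?U * nrm g'"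
          using wronskian_harmonic_bound[OF u g k] by (simp add: t_def[abs_def])
        also have "\<dots> \<le> C" using mult_nonneg_nonneg[OF U norm_nonneg[of h']]
          by (simp add: C_def A_def H_def distrib_left)
        finally show ?thesis .
      qed
      have W2: "\<bar>wronskian u h k\<bar> \<le> C"
      proof -
        have "\<bar>wronskian u h k\<bar> \<le> \<bar>wronskian u h M\<bar> + ?U * nrm h'"
          using wronskian_harmonic_bound[OF u h k] by (simp add: t_def[abs_def])
        also have "\<dots> \<le> C" using mult_nonneg_nonneg[OF U norm_nonneg[of g']]
          by (simp add: C_def A_def H_def distrib_left)
        finally show ?thesis .
      qed
      have "\<bar>\<omega>\<bar> / 2 \<le> \<bar>wronskian g h k\<bar>" using N3[of k] k by (simp add: M_def)
      then have "t u k * (\<bar>\<omega>\<bar> / 2) \<le> t u k * \<bar>wronskian g h k\<bar>"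
        by (intro mult_left_mono t_nonneg)
      also have "\<dots> = \<bar>u (v k) * wronskian g h k\<bar> * sqrt (m (v k))" by (simp add: t_def abs_mult)
      \<comment> \<open>Cramer's rule: \<open>u\<close> as a combination of \<open>g\<close> and
        \<open>h\<close> with Wronskians as coefficients.\<close>
      also have "u (v k) * wronskian g h k = wronskian u h k * g (v k) - wronskian u g k * h (v k)"
        by (simp add: wronskian_def algebra_simps)
      also have "\<bar>\<dots>\<bar> \<le> \<bar>wronskian u h k\<bar> * \<bar>g (v k)\<bar> + \<bar>wronskian u g k\<bar> * \<bar>h (v k)\<bar>"
        unfolding abs_mult[symmetric] by (rule abs_triangle_ineq4)
      also have "\<dots> \<le> C * \<bar>g (v k)\<bar> + C * \<bar>h (v k)\<bar>"
        by (intro add_mono mult_right_mono W1 W2) auto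
      finally show ?thesis by (simp add: t_def less_imp_le algebra_simps)
    qed
    then have "L2_set (\<lambda>k. t u k * (\<bar>\<omega>\<bar> / 2)) {M..<n} \<le> L2_set (\<lambda>k. C * t g k + C * t h k) {M..<n}"
      using t_nonneg by (intro L2_set_mono) auto
    also have "\<dots> \<le> L2_set (\<lambda>k. C * t g k) {M..<n} + L2_set (\<lambda>k. C * t h k) {M..<n}"
      by (rule L2_set_triangle_ineq)
    also have "\<dots> = C * L2_set (t g) {M..<n} + C * L2_set (t h) {M..<n}"
      using C by (simp add: L2_set_right_distrib)
    also have "\<dots> \<le> C * \<delta> + C * \<delta>"
      using C by (intro add_mono mult_left_mono N1 N2) (auto simp: M_def)
    finally have "?U * (\<bar>\<omega>\<bar> / 2) \<le> 2 * \<delta> * C"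
      using L2_set_left_distrib[of "\<bar>\<omega>\<bar> / 2" "t u" "{M..<n}"] by (simp add: mult_ac)
    also have "\<dots> = 2 * \<delta> * A + ?U * (2 * \<delta> * H)" by (simp add: C_def algebra_simps)
    also have "\<dots> \<le> 2 * \<delta> * A + ?U * (\<bar>\<omega>\<bar> / 4)"
      by (intro add_left_mono mult_left_mono \<delta>H U)
    \<comment> \<open>\<open>?U\<close> is a finite quantity, so its part on the right can be
      subtracted; the resulting bound \<open>B\<close> is independent of n.\<close>
    finally have "?U * (\<bar>\<omega>\<bar> / 4) \<le> 2 * \<delta> * A" by (simp add: field_simps)
    then show ?thesis unfolding B_def using \<omega> by (subst pos_le_divide_eq) auto
  qed
  let ?s = "\<lambda>k. (u (v k))\<^sup>2 * m (v k)"
  show ?thesis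
  proof (rule summableI_nonneg_bounded)
    show s0: "0 \<le> ?s k" for k by (simp add: less_imp_le)
    fix n
    have ts: "(t u k)\<^sup>2 = ?s k" for k by (simp add: t_def power_mult_distrib less_imp_le)
    have "(\<Sum>k<n. ?s k) \<le> (\<Sum>k<M + n. ?s k)" by (intro sum_mono2) (auto simp: s0)
    also have "\<dots> = (\<Sum>k<M. ?s k) + (\<Sum>k=M..<M + n. ?s k)"
      using sum.atLeastLessThan_concat[of 0 M "M + n" ?s] by (simp add: lessThan_atLeast0)
    also have "(\<Sum>k=M..<M + n. ?s k) = (L2_set (t u) {M..<M + n})\<^sup>2"
      by (simp add: L2_set_def sum_nonneg ts s0)
    also have "\<dots> \<le> B\<^sup>2" by (intro power_mono bound L2_set_nonneg)
    finally show "(\<Sum>k<n. ?s k) \<le> (\<Sum>k<M. ?s k) + B\<^sup>2" by simp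
  qed
qed

text \<open>Weyl's argument is applied in contraposed form with \<open>resistance_function\<close>
  as \<open>u\<close>: if it is not square summable, all boundary forms at infinity vanish.\<close>

theorem essentially_self_adjoint_iff:
  "essentially_self_adjoint X m minop \<longleftrightarrow> \<not> summable (\<lambda>k. (resistance k)\<^sup>2 * m (v k))"
proof
  assume "\<not> summable (\<lambda>k. (resistance k)\<^sup>2 * m (v k))"
  then have "wronskian g h \<longlonglongrightarrow> 0" if "(g, g') \<in> maxop" "(h, h') \<in> maxop" for g g' h h'
    using summable_if_wronskian_nonzero[OF that _ laplacian_resistance_function_Suc] by auto
  then show "essentially_self_adjoint X m minop"
    by (rule essentially_self_adjoint_if_wronskian_tendsto_0)
qed (use not_essentially_self_adjoint_if_summable in blast)

end

section \<open>Stars with two rays\<close>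

lemma int_shift_invariant_const:
  fixes d :: "int \<Rightarrow> 'a"
  assumes "\<And>x. d (x + 1) = d x"
  shows "d x = d 0"
proof (induction x rule: int_induct[where k = 0])
  case (step2 i)
  then show ?case using assms[of "i - 1"] by simp
qed (use assms in auto)

locale star =
  fixes b :: "int \<Rightarrow> int \<Rightarrow> real" and m :: "int \<Rightarrow> real"
  assumes star: "star_with_two_rays b m"
begin

lemma b_pos_iff: "b x y > 0 \<longleftrightarrow> \<bar>x - y\<bar> = 1"
  using star by (simp add: star_with_two_rays_def)

lemma weighted_graph: "weighted_graph X m b"
proof
  fix x y :: int
  show "m x > 0" "b x y = b y x" "b x y \<ge> 0" using star by (auto simp: star_with_two_rays_def)
  have "{y \<in> X. b x y \<noteq> 0} \<subseteq> {x - 1, x + 1}"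
  proof
    fix y assume "y \<in> {y \<in> X. b x y \<noteq> 0}"
    then have "b x y > 0" using star by (auto simp: star_with_two_rays_def less_le)
    then show "y \<in> {x - 1, x + 1}" by (auto simp: b_pos_iff)
  qed
  then show "finite {y \<in> X. b x y \<noteq> 0}" by (rule finite_subset) simp
qed

sublocale Z: weighted_graph UNIV m b
  by (rule weighted_graph)

sublocale pos: ray "{1..}" m b "\<lambda>k. int k + 1"
proof -
  interpret weighted_graph "{1..}" m b by (rule weighted_graph)
  have "x \<in> range (\<lambda>k. int k + 1)" if "x \<ge> 1" for x
    using that by (intro range_eqI[of _ _ "nat (x - 1)"]) simp
  then show "ray {1..} m b (\<lambda>k. int k + 1)"
    by unfold_locales (auto simp: inj_on_def b_pos_iff)
qed

sublocale neg: ray "{..-1}" m b "\<lambda>k. - int k - 1"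
proof -
  interpret weighted_graph "{..-1}" m b by (rule weighted_graph)
  have "x \<in> range (\<lambda>k. - int k - 1)" if "x \<le> -1" for x
    using that by (intro range_eqI[of _ _ "nat (- x - 1)"]) simp
  then show "ray {..-1} m b (\<lambda>k. - int k - 1)"
    by unfold_locales (auto simp: inj_on_def b_pos_iff)
qed

section \<open>Harmonic functions on the integers\<close>

lemma edge_pos: "b x (x + 1) > 0"
  by (simp add: b_pos_iff)

text \<open>The Laplacian at x, times the measure, is the flux entering x minus the flux leaving
  it.\<close>

lemma harmonic_iff: "harmonic UNIV b m f \<longleftrightarrow> (\<exists>a. \<forall>x. b x (x + 1) * (f (x + 1) - f x) = a)"
proof -
  define d where "d x = b x (x + 1) * (f (x + 1) - f x)" for x
  have L: "laplacian UNIV b m f x * m x = d (x - 1) - d x" for x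
  proof -
    have "y \<in> {y \<in> UNIV. b x y \<noteq> 0} \<longleftrightarrow> y \<in> {x - 1, x + 1}" for y
      using b_pos_iff[of x y] Z.b_nonneg[of x y] by auto
    then have "{y \<in> UNIV. b x y \<noteq> 0} = {x - 1, x + 1}" by blast
    then show ?thesis
      using Z.b_sym[of x "x - 1"] by (subst Z.laplacian_finite_sum) (simp_all add: d_def algebra_simps)
  qed
  have "harmonic UNIV b m f \<longleftrightarrow> (\<forall>x. laplacian UNIV b m f x * m x = 0)"
    using Z.m_pos by (auto simp: harmonic_def less_le)
  also have "\<dots> \<longleftrightarrow> (\<forall>x. d (x - 1) = d x)" by (simp add: L)
  also have "\<dots> \<longleftrightarrow> (\<exists>a. \<forall>x. d x = a)"
  proof
    assume h: "\<forall>x. d (x - 1) = d x"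
    have "d (x + 1) = d x" for x using h[rule_format, of "x + 1"] by simp
    then show "\<exists>a. \<forall>x. d x = a" using int_shift_invariant_const[of d] by blast
  qed auto
  finally show ?thesis by (simp add: d_def)
qed

lemma l2_iff: "f \<in> l2 UNIV m \<longleftrightarrow>
    summable (\<lambda>k. (f (int k + 1))\<^sup>2 * m (int k + 1)) \<and>
    summable (\<lambda>k. (f (- int k - 1))\<^sup>2 * m (- int k - 1))"
proof -
  let ?s = "\<lambda>x. (f x)\<^sup>2 * m x"
  have U: "(UNIV :: int set) = {1..} \<union> ({0} \<union> {..-1})" by auto
  have "?s summable_on UNIV \<longleftrightarrow> ?s summable_on {1..} \<and> ?s summable_on {..-1}"
  proof
    assume "?s summable_on {1..} \<and> ?s summable_on {..-1}"
    then show "?s summable_on UNIV"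
      unfolding U by (intro summable_on_Un_disjoint) auto
  qed (auto intro: summable_on_subset_banach)
  then show ?thesis by (simp add: l2_def pos.summable_on_ray_iff neg.summable_on_ray_iff)
qed

text \<open>Summing the increments \<open>a / b x (x + 1)\<close> along a ray gives the resistance.
  The negative ray is traversed outwards, against the direction in which the flux \<open>a\<close>
  is measured, hence the sign.\<close>

lemma
  assumes a: "\<And>x. b x (x + 1) * (f (x + 1) - f x) = a"
  shows harmonic_pos: "f (int k + 1) = f 1 + a * pos.resistance k"
    and harmonic_neg: "f (- int k - 1) = f (- 1) + (- a) * neg.resistance k"
proof -
  have step: "f (x + 1) - f x = a / b x (x + 1)" for x
    using a[of x] edge_pos[of x] by (simp add: field_simps)
  show "f (int k + 1) = f 1 + a * pos.resistance k"
  proof (induction k)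
    case (Suc k)
    have "f (int (Suc k) + 1) = f (int k + 1) + a / pos.c k"
      using step[of "int k + 1"] by (simp add: pos.c_def)
    then show ?case using Suc by (simp add: pos.resistance_def distrib_left)
  qed (simp add: pos.resistance_def)
  show "f (- int k - 1) = f (- 1) + (- a) * neg.resistance k"
  proof (induction k)
    case (Suc k)
    have "f (- int (Suc k) - 1) = f (- int k - 1) - a / neg.c k"
    proof -
      have e: "- int (Suc k) - 1 = - int k - 2" "- int k - 2 + 1 = - int k - 1" by simp_all
      show ?thesis
        using step[of "- int k - 2"]
        unfolding neg.c_def e Z.b_sym[of "- int k - 1" "- int k - 2"] by linarith
    qed
    then show ?case using Suc by (simp add: neg.resistance_def distrib_left)
  qed (simp add: neg.resistance_def)
qed

text \<open>The signed resistance from 0, that is, the harmonic function of unit flux that vanishes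
  at 0.\<close>

definition potential :: "int \<Rightarrow> real" where
  "potential x = (if x \<ge> 0 then (\<Sum>i<nat x. 1 / b (int i) (int i + 1))
                  else - (\<Sum>i<nat (- x). 1 / b (- int i - 1) (- int i)))"

lemma flux_potential: "b x (x + 1) * (potential (x + 1) - potential x) = 1"
proof -
  have "potential (x + 1) - potential x = 1 / b x (x + 1)"
  proof (cases "x \<ge> 0")
    case True
    then have "nat (x + 1) = Suc (nat x)" by simp
    then show ?thesis using True by (simp add: potential_def)
  next
    case False
    then have n: "nat (- x) = Suc (nat (- x - 1))" by simp
    have "potential (x + 1) = - (\<Sum>i<nat (- x - 1). 1 / b (- int i - 1) (- int i))"
      using False by (cases "x = -1") (auto simp: potential_def)
    moreover have "potential x = - (\<Sum>i<Suc (nat (- x - 1)). 1 / b (- int i - 1) (- int i))"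
      using False by (simp add: potential_def n)
    ultimately show ?thesis using False by (simp add: add.commute)
  qed
  then show ?thesis using edge_pos[of x] by simp
qed

end

section \<open>Joining the two rays\<close>

theorem proposition4p39:
  fixes b :: "int \<Rightarrow> int \<Rightarrow> real" and m :: "int \<Rightarrow> real"
  assumes "star_with_two_rays b m"
    and "recurrent_graph UNIV b m"
  shows "\<not> l2_liouville UNIV b m \<longleftrightarrow>
    \<not> essentially_self_adjoint {1..} m (minimal_laplacian {1..} b m) \<and>
    \<not> essentially_self_adjoint {..-1} m (minimal_laplacian {..-1} b m)"
proof -
  interpret star b m by unfold_locales (rule assms(1))
  show ?thesis
    unfolding pos.essentially_self_adjoint_iff neg.essentially_self_adjoint_iff not_not
  proof
    assume "\<not> l2_liouville UNIV b m"
    then obtain f where f: "f \<in> l2 UNIV m" "harmonic UNIV b m f" and nc: "\<nexists>c. \<forall>x. f x = c"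
      by (auto simp: l2_liouville_def)
    obtain a where a: "\<And>x. b x (x + 1) * (f (x + 1) - f x) = a"
      using f(2) unfolding harmonic_iff by blast
    have "a \<noteq> 0"
    proof
      assume "a = 0"
      then have "f (x + 1) = f x" for x using a[of x] edge_pos[of x] by simp
      then show False using nc int_shift_invariant_const[of f] by blast
    qed
    \<comment> \<open>Recurrence enters here: divergence of both resistances allows the additive
      constants of \<open>f\<close> on the rays to be discarded.\<close>
    have "\<not> summable (\<lambda>k. 1 / pos.c k)" "\<not> summable (\<lambda>k. 1 / neg.c k)"
      unfolding pos.c_def neg.c_def
      by (rule Z.recurrent_imp_divergent_resistance[OF assms(2)]; simp add: inj_on_def b_pos_iff)+
    moreover have "summable (\<lambda>k. (f 1 + a * pos.resistance k)\<^sup>2 * m (int k + 1))"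
      "summable (\<lambda>k. (f (- 1) + (- a) * neg.resistance k)\<^sup>2 * m (- int k - 1))"
      using f(1) unfolding l2_iff harmonic_pos[OF a] harmonic_neg[OF a] by auto
    ultimately show "summable (\<lambda>k. (pos.resistance k)\<^sup>2 * m (int k + 1)) \<and>
        summable (\<lambda>k. (neg.resistance k)\<^sup>2 * m (- int k - 1))"
      using pos.summable_resistance[of a "f 1"] neg.summable_resistance[of "- a" "f (- 1)"] \<open>a \<noteq> 0\<close>
      by simp
  next
    assume "summable (\<lambda>k. (pos.resistance k)\<^sup>2 * m (int k + 1)) \<and>
        summable (\<lambda>k. (neg.resistance k)\<^sup>2 * m (- int k - 1))"
    \<comment> \<open>On each ray \<open>potential\<close> is affine in the resistance, with
      different constants as the rays start at 1 and -1; finite measure of the rays takes care of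
      these.\<close>
    then have "potential \<in> l2 UNIV m"
      unfolding l2_iff harmonic_pos[OF flux_potential] harmonic_neg[OF flux_potential]
      by (intro conjI pos.summable_affine_resistance neg.summable_affine_resistance) auto
    moreover have "harmonic UNIV b m potential"
      unfolding harmonic_iff using flux_potential by blast
    moreover have "potential 1 \<noteq> potential 0"
      using flux_potential[of 0] by auto
    ultimately show "\<not> l2_liouville UNIV b m"
      unfolding l2_liouville_def by (metis UNIV_I)
  qed
qed

end
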